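(* For any $a_0,b_0\in\mathbb R$ with $a_0>b_0$ and any $\dot a_0,\dot b_0\in\,]-1,1[$, there is at least one pair of trajectories $a,b\in C^\infty(\mathbb R)$ such that for all $t\in\mathbb R$ $$\frac{d}{dt}\left(\frac{\dot a(t)}{\sqrt{1-\dot a(t)^2}}\right)=\frac1{(a(t)-b(t_2^-))^2}+\frac1{(a(t)-b(t_2^+))^2},$$ $$\frac{d}{dt}\left(\frac{\dot b(t)}{\sqrt{1-\dot b(t)^2}}\right)=-\frac1{(b(t)-a(t_1^-))^2}-\frac1{(b(t)-a(t_1^+))^2},$$ where $t_i^\pm=t_i^\pm(a,b,t)$, and $$a(0)=a_0,\quad \dot a(0)=\dot a_0,\quad b(0)=b_0,\quad \dot b(0)=\dot b_0 .$$
   Context: For trajectories $a,b:\mathbb R\to\mathbb R$, the advanced ($+$) and retarded ($-$) times are defined implicitly by $$t_1^\pm(a,b,t)=t\pm|a(t_1^\pm(a,b,t))-b(t)|,\qquad t_2^\pm(a,b,t)=t\pm|a(t)-b(t_2^\pm(a,b,t))|.$$ That $(a,b)$ satisfies the equations includes that $|\dot a|,|\dot b|<1$ pointwise, that the advanced and retarded times exist for all $t$, and that the denominators do not vanish. *)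

theory Defs
  imports "HOL-Analysis.Analysis"
begin

text \<open>
  The class \<open>C\<^sup>\<infinity>(\<real>)\<close>: every iterated derivative exists everywhere. Since \<^const>\<open>deriv\<close> is total,
  differentiability of each iterate has to be demanded explicitly.
\<close>

definition smooth :: "(real \<Rightarrow> real) \<Rightarrow> bool" where
  "smooth f \<longleftrightarrow> (\<forall>n t. ((deriv ^^ n) f) differentiable (at t))"

text \<open>
  Each time is the solution \<open>s\<close> of an implicit equation. Existence is a clause of
  \<open>FST_solution\<close> below, and uniqueness follows from the speed bound
  (\<open>advanced_time_unique\<close>, \<open>retarded_time_unique\<close>), so the descriptions are well defined
  on solutions.
\<close>

definition t1_adv :: "(real \<Rightarrow> real) \<Rightarrow> (real \<Rightarrow> real) \<Rightarrow> real \<Rightarrow> real" where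
  "t1_adv a b t = (THE s. s = t + \<bar>a s - b t\<bar>)"

definition t1_ret :: "(real \<Rightarrow> real) \<Rightarrow> (real \<Rightarrow> real) \<Rightarrow> real \<Rightarrow> real" where
  "t1_ret a b t = (THE s. s = t - \<bar>a s - b t\<bar>)"

definition t2_adv :: "(real \<Rightarrow> real) \<Rightarrow> (real \<Rightarrow> real) \<Rightarrow> real \<Rightarrow> real" where
  "t2_adv a b t = (THE s. s = t + \<bar>a t - b s\<bar>)"

definition t2_ret :: "(real \<Rightarrow> real) \<Rightarrow> (real \<Rightarrow> real) \<Rightarrow> real \<Rightarrow> real" where
  "t2_ret a b t = (THE s. s = t - \<bar>a t - b s\<bar>)"

lemma subluminal_less:
  fixes f :: "real \<Rightarrow> real"
  assumes "\<And>t. f differentiable (at t)" "\<And>t. \<bar>deriv f t\<bar> < 1" "x < y"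
  shows "\<bar>f y - f x\<bar> < y - x"
proof -
  have "\<And>t. (f has_real_derivative deriv f t) (at t)"
    using assms(1) DERIV_deriv_iff_real_differentiable by blast
  then obtain z where "f y - f x = (y - x) * deriv f z"
    using MVT2[OF assms(3), of f "deriv f"] by blast
  then have "\<bar>f y - f x\<bar> = (y - x) * \<bar>deriv f z\<bar>"
    using assms(3) by (simp add: abs_mult)
  also have "\<dots> < (y - x) * 1"
    using assms(2)[of z] assms(3) by (intro mult_strict_left_mono) auto
  finally show ?thesis by simp
qed

lemma advanced_time_unique:
  fixes f :: "real \<Rightarrow> real"
  assumes "\<And>t. f differentiable (at t)" "\<And>t. \<bar>deriv f t\<bar> < 1"
    and "s = t + \<bar>f s - c\<bar>" "s' = t + \<bar>f s' - c\<bar>"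
  shows "s = s'"
proof (rule ccontr)
  assume "s \<noteq> s'"
  then consider "s < s'" | "s' < s" by linarith
  then show False
    using subluminal_less[OF assms(1,2), of s s'] subluminal_less[OF assms(1,2), of s' s] assms(3,4)
    by cases (auto simp: abs_if split: if_splits)
qed

lemma retarded_time_unique:
  fixes f :: "real \<Rightarrow> real"
  assumes "\<And>t. f differentiable (at t)" "\<And>t. \<bar>deriv f t\<bar> < 1"
    and "s = t - \<bar>f s - c\<bar>" "s' = t - \<bar>f s' - c\<bar>"
  shows "s = s'"
proof (rule ccontr)
  assume "s \<noteq> s'"
  then consider "s < s'" | "s' < s" by linarith
  then show False
    using subluminal_less[OF assms(1,2), of s s'] subluminal_less[OF assms(1,2), of s' s] assms(3,4)
    by cases (auto simp: abs_if split: if_splits)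
qed

text \<open>
  The Fokker-Schwarzschild-Tetrode equations of motion, together with the conditions under which they make sense. Division
  by zero is total here, so the nonvanishing of the denominators is a separate clause; that of
  the square roots follows from the speed bounds.
\<close>

definition FST_solution :: "(real \<Rightarrow> real) \<Rightarrow> (real \<Rightarrow> real) \<Rightarrow> bool" where
  "FST_solution a b \<longleftrightarrow>
     (\<forall>t. \<bar>deriv a t\<bar> < 1 \<and> \<bar>deriv b t\<bar> < 1) \<and>
     (\<forall>t. (\<exists>s. s = t + \<bar>a s - b t\<bar>) \<and> (\<exists>s. s = t - \<bar>a s - b t\<bar>) \<and>
          (\<exists>s. s = t + \<bar>a t - b s\<bar>) \<and> (\<exists>s. s = t - \<bar>a t - b s\<bar>)) \<and>
     (\<forall>t. a t - b (t2_ret a b t) \<noteq> 0 \<and> a t - b (t2_adv a b t) \<noteq> 0 \<and>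
          b t - a (t1_ret a b t) \<noteq> 0 \<and> b t - a (t1_adv a b t) \<noteq> 0) \<and>
     (\<forall>t. ((\<lambda>\<tau>. deriv a \<tau> / sqrt (1 - (deriv a \<tau>)\<^sup>2)) has_real_derivative
             1 / (a t - b (t2_ret a b t))\<^sup>2 + 1 / (a t - b (t2_adv a b t))\<^sup>2) (at t)) \<and>
     (\<forall>t. ((\<lambda>\<tau>. deriv b \<tau> / sqrt (1 - (deriv b \<tau>)\<^sup>2)) has_real_derivative
             - (1 / (b t - a (t1_ret a b t))\<^sup>2) - 1 / (b t - a (t1_adv a b t))\<^sup>2) (at t))"

end

theory Submission
  imports Defs "HOL-Complex_Analysis.Great_Picard"
begin

text \<open>
  Truncate the Coulomb force at distances below a cutoff and the speed at a bound below the speed of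
  light. Then all delays exist and depend continuously on the trajectories, and the truncated
  equations with the given Cauchy data have a global solution by a Schauder type argument: polygonal
  approximations are found by Brouwer's theorem (in the combinatorial form of Kuhn's lemma), and
  Lipschitz curves are compact under pointwise convergence.

  A solution of the truncated equations never reaches the truncation. Both velocities are monotone
  because the force is repulsive, so during an approach they stay between their initial values. Hence
  the retarded delay is at most a constant multiple of the distance \<open>d\<close>, the force is at least
  \<open>const / d\<^sup>2\<close>, and bounded momentum transfer keeps \<open>d\<close> above a
  constant. By the same lower bound on the force the particles eventually separate at a definite
  rate, so the total momentum transfer is finite and the speeds are bounded away from the speed of
  light. All these bounds depend on the Cauchy data only, and the cutoffs are chosen accordingly.
  Smoothness follows by bootstrapping, since the delays are as smooth as the trajectories.
\<close>

section \<open>Brouwer's theorem on a box of arbitrary dimension\<close>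

text \<open>The dimension is a variable because it will be the number of slopes of a polygonal
  curve. Only the first \<open>n\<close> coordinates of a point count: \<open>cont\<close> is
  sequential continuity in them and forces \<open>f\<close> to ignore the others on the box.\<close>

lemma box_fixed_point:
  fixes f :: "(nat \<Rightarrow> real) \<Rightarrow> nat \<Rightarrow> real"
  assumes r: "\<And>i. i < n \<Longrightarrow> 0 \<le> r i"
    and bounded: "\<And>y i. \<forall>j<n. \<bar>y j\<bar> \<le> r j \<Longrightarrow> i < n \<Longrightarrow> \<bar>f y i\<bar> \<le> r i"
    and cont: "\<And>Y y i. \<forall>k. \<forall>j<n. \<bar>Y k j\<bar> \<le> r j \<Longrightarrow> \<forall>j<n. (\<lambda>k. Y k j) \<longlonglongrightarrow> y j \<Longrightarrow> i < n
      \<Longrightarrow> (\<lambda>k. f (Y k) i) \<longlonglongrightarrow> f y i"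
  shows "\<exists>y. \<forall>i<n. \<bar>y i\<bar> \<le> r i \<and> f y i = y i"
proof -
  \<comment> \<open>Grid with \<open>p\<close> cells per axis: as \<open>x j\<close> runs from
    \<open>0\<close> to \<open>p\<close>, the coordinate runs from \<open>- r j\<close> to
    \<open>r j\<close>.\<close>
  define pt :: "nat \<Rightarrow> (nat \<Rightarrow> nat) \<Rightarrow> nat \<Rightarrow> real"
    where "pt p x j = r j * (2 * real (x j) / real p - 1)" for p x j
  have pt_box: "\<bar>pt p x j\<bar> \<le> r j" if "x j \<le> p" "0 < p" "j < n" for p x j
  proof -
    have "\<bar>2 * real (x j) / real p - 1\<bar> \<le> 1"
      using that by (simp add: abs_le_iff field_simps)
    then show ?thesis
      using r[OF that(3)] by (simp add: pt_def abs_mult mult_left_le)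
  qed
  have pt_near: "\<bar>pt p x j - pt p q j\<bar> \<le> 2 * r j / real p"
    if "q j \<le> x j" "x j \<le> q j + 1" "0 < p" "j < n" for p x q j
  proof -
    have "pt p x j - pt p q j = (2 * r j / real p) * (real (x j) - real (q j))"
      using that(3) by (simp add: pt_def field_simps)
    moreover have "\<bar>real (x j) - real (q j)\<bar> \<le> 1"
      using that by linarith
    ultimately show ?thesis
      using r[OF that(4)] by (simp add: abs_mult mult_left_le divide_right_mono)
  qed
  \<comment> \<open>What Kuhn's lemma yields at resolution \<open>p\<close>: a cell \<open>q\<close>
    and, for every axis \<open>i\<close>, two nearby points \<open>U i\<close> and
    \<open>W i\<close> at which \<open>f\<close> does not lower, respectively does not raise,
    coordinate \<open>i\<close>.\<close>
  define R where "R p q U W \<longleftrightarrow> (\<forall>i<n. q i < p) \<and> (\<forall>i<n. \<forall>j<n.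
      \<bar>U i j\<bar> \<le> r j \<and> \<bar>W i j\<bar> \<le> r j \<and>
      \<bar>U i j - pt p q j\<bar> \<le> 2 * r j / real p \<and> \<bar>W i j - pt p q j\<bar> \<le> 2 * r j / real p) \<and>
      (\<forall>i<n. U i i \<le> f (U i) i \<and> f (W i) i \<le> W i i)" for p q U W
  have corners: "\<exists>q U W. R p q U W"
    if p: "0 < p" for p
  proof -
    \<comment> \<open>Label 0 means that \<open>f\<close> does not lower coordinate
      \<open>i\<close>. On the upper face Kuhn's lemma requires label 1 even where \<open>f\<close>
      fixes the coordinate; label 1 still means that \<open>f\<close> does not raise it, since
      \<open>f\<close> stays in the box.\<close>
    define label :: "(nat \<Rightarrow> nat) \<Rightarrow> nat \<Rightarrow> nat" where
      "label x i = (if x i = p then 1 else if pt p x i \<le> f (pt p x) i then 0 else 1)" for x i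
    have f_pt: "\<bar>f (pt p x) i\<bar> \<le> r i" if "\<forall>i<n. x i \<le> p" "i < n" for x i
      using bounded pt_box p that by blast
    have l0: "label x i = 0" if "\<forall>i<n. x i \<le> p" "i < n" "x i = 0" for x i
      using f_pt[OF that(1,2)] that p by (simp add: label_def pt_def)
    have l1: "label x i = 1" if "\<forall>i<n. x i \<le> p" "i < n" "x i = p" for x i
      using that p by (simp add: label_def)
    obtain q where q: "\<forall>i<n. q i < p"
      and "\<forall>i<n. \<exists>s t. (\<forall>j<n. q j \<le> s j \<and> s j \<le> q j + 1) \<and>
        (\<forall>j<n. q j \<le> t j \<and> t j \<le> q j + 1) \<and> label s i \<noteq> label t i"
    proof (rule kuhn_lemma[OF p, of n label])
      show "\<forall>x. (\<forall>i<n. x i \<le> p) \<longrightarrow> (\<forall>i<n. label x i = 0 \<or> label x i = 1)"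
        by (simp add: label_def)
    qed (use l0 l1 in blast)+
    then obtain S T where ST: "\<And>i j. i < n \<Longrightarrow> j < n \<Longrightarrow> q j \<le> S i j \<and> S i j \<le> q j + 1"
        "\<And>i j. i < n \<Longrightarrow> j < n \<Longrightarrow> q j \<le> T i j \<and> T i j \<le> q j + 1"
        "\<And>i. i < n \<Longrightarrow> label (S i) i \<noteq> label (T i) i"
      by metis
    have STp: "S i j \<le> p" "T i j \<le> p" if "i < n" "j < n" for i j
      using ST(1,2)[OF that] q that by (metis Suc_eq_plus1 Suc_leI le_trans)+
    define U where "U i = pt p (if label (S i) i = 0 then S i else T i)" for i
    define W where "W i = pt p (if label (S i) i = 0 then T i else S i)" for i
    have lab0: "pt p x i \<le> f (pt p x) i" if "label x i = 0" for x i
      using that by (auto simp: label_def split: if_splits)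
    have lab1: "f (pt p x) i \<le> pt p x i" if "label x i \<noteq> 0" "\<forall>j<n. x j \<le> p" "i < n" for x i
      using that f_pt[OF that(2,3)] p by (auto simp: label_def pt_def split: if_splits)
    have UW: "U i i \<le> f (U i) i \<and> f (W i) i \<le> W i i" if i: "i < n" for i
    proof -
      have "label (S i) i = 0 \<and> label (T i) i \<noteq> 0 \<or> label (S i) i \<noteq> 0 \<and> label (T i) i = 0"
        using ST(3)[OF i] by (auto simp: label_def split: if_splits)
      then show ?thesis
        using lab0[of "S i" i] lab0[of "T i" i] lab1[of "S i" i] lab1[of "T i" i] STp[OF i] i
        unfolding U_def W_def by (elim disjE conjE) simp_all
    qed
    have "\<bar>U i j\<bar> \<le> r j \<and> \<bar>W i j\<bar> \<le> r j \<and>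
      \<bar>U i j - pt p q j\<bar> \<le> 2 * r j / real p \<and> \<bar>W i j - pt p q j\<bar> \<le> 2 * r j / real p"
      if "i < n" "j < n" for i j
      unfolding U_def W_def using ST(1,2)[OF that] STp[OF that] p that
      by (auto intro!: pt_box pt_near)
    then show ?thesis
      using q UW unfolding R_def by blast
  qed
  have "\<exists>q U W. \<forall>k. R (Suc k) (q k) (U k) (W k)"
    using corners[OF zero_less_Suc] by metis
  then obtain q U W where q: "\<And>k i. i < n \<Longrightarrow> q k i < Suc k"
    and box: "\<And>k i j. i < n \<Longrightarrow> j < n \<Longrightarrow> \<bar>U k i j\<bar> \<le> r j" "\<And>k i j. i < n \<Longrightarrow> j < n \<Longrightarrow> \<bar>W k i j\<bar> \<le> r j"
    and near: "\<And>k i j. i < n \<Longrightarrow> j < n \<Longrightarrow> \<bar>U k i j - pt (Suc k) (q k) j\<bar> \<le> 2 * r j / real (Suc k)"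
      "\<And>k i j. i < n \<Longrightarrow> j < n \<Longrightarrow> \<bar>W k i j - pt (Suc k) (q k) j\<bar> \<le> 2 * r j / real (Suc k)"
    and sgn: "\<And>k i. i < n \<Longrightarrow> U k i i \<le> f (U k i) i" "\<And>k i. i < n \<Longrightarrow> f (W k i) i \<le> W k i i"
    unfolding R_def by blast
  define z where "z k = pt (Suc k) (q k)" for k
  have z_box: "\<bar>z k j\<bar> \<le> r j" if "j < n" for k j
    unfolding z_def using q[OF that, of k] that by (intro pt_box) auto
  \<comment> \<open>The diagonal argument takes a single bound for all coordinates; the sum of the
    radii serves.\<close>
  have "norm (z k j) \<le> (\<Sum>i<n. r i)" if "j \<in> {..<n}" for k j
    using z_box[of j k] that r by (auto intro!: order_trans[OF _ member_le_sum[of j "{..<n}" r]])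
  then obtain h where h: "strict_mono (h :: nat \<Rightarrow> nat)" "\<And>j. j \<in> {..<n} \<Longrightarrow> \<exists>l. (\<lambda>k. z (h k) j) \<longlonglongrightarrow> l"
    using function_convergent_subsequence[of "{..<n}" z] by (metis finite_lessThan countable_finite)
  then obtain l where l: "\<And>j. j < n \<Longrightarrow> (\<lambda>k. z (h k) j) \<longlonglongrightarrow> l j"
    by (metis lessThan_iff)
  have small: "(\<lambda>k. 2 * r j / real (Suc (h k))) \<longlonglongrightarrow> 0" for j
    using LIMSEQ_subseq_LIMSEQ[OF LIMSEQ_Suc[OF lim_const_over_n[of "2 * r j"]] h(1)]
    by (simp add: o_def)
  have near_lim: "(\<lambda>k. V (h k) j) \<longlonglongrightarrow> l j"
    if "\<And>k. \<bar>V k j - z k j\<bar> \<le> 2 * r j / real (Suc k)" "j < n" for V :: "nat \<Rightarrow> nat \<Rightarrow> real" and j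
  proof -
    have "(\<lambda>k. V (h k) j - z (h k) j) \<longlonglongrightarrow> 0"
      by (rule Lim_null_comparison[OF _ small[of j]]) (use that(1) in auto)
    from tendsto_add[OF this l[OF that(2)]] show ?thesis by simp
  qed
  \<comment> \<open>The cells shrink to \<open>l\<close>, so \<open>U\<close> and \<open>W\<close>
    have the same limit and the two opposite inequalities meet there.\<close>
  have "\<bar>l i\<bar> \<le> r i \<and> f l i = l i" if i: "i < n" for i
  proof -
    have Ul: "\<forall>j<n. (\<lambda>k. U (h k) i j) \<longlonglongrightarrow> l j" and Wl: "\<forall>j<n. (\<lambda>k. W (h k) i j) \<longlonglongrightarrow> l j"
      using near_lim[of "\<lambda>k. U k i"] near_lim[of "\<lambda>k. W k i"] near i unfolding z_def by blast+
    have "l i \<le> f l i"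
      by (rule LIMSEQ_le[OF Ul[rule_format, OF i] cont[OF _ Ul i]]) (use box i sgn in auto)
    moreover have "f l i \<le> l i"
      by (rule LIMSEQ_le[OF cont[OF _ Wl i] Wl[rule_format, OF i]]) (use box i sgn in auto)
    moreover have "\<bar>l i\<bar> \<le> r i"
      by (rule LIMSEQ_le_const2[OF tendsto_rabs[OF l[OF i]]]) (use z_box i in auto)
    ultimately show ?thesis by simp
  qed
  then show ?thesis by blast
qed

section \<open>Functional differential equations of mixed type\<close>

text \<open>For \<open>u \<le> v\<close> the projection onto an interval. The difference
  \<open>clip u v t - clip u v s\<close> is the signed length of the part of the interval passed
  between \<open>s\<close> and \<open>t\<close>, so weighted sums of such differences are integrals
  of step functions.\<close>

definition clip :: "real \<Rightarrow> real \<Rightarrow> real \<Rightarrow> real" where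
  "clip u v t = max u (min t v)"

lemma clip_mono: "s \<le> t \<Longrightarrow> clip u v s \<le> clip u v t"
  by (auto simp: clip_def)

text \<open>The cells are adjacent: at every point one of the clips to two neighbouring intervals
  sits at the common end point, so the lengths add up.\<close>

lemma sum_clip:
  assumes "\<And>i. g i \<le> g (Suc i)"
  shows "(\<Sum>i<N. clip (g i) (g (Suc i)) t - clip (g i) (g (Suc i)) s) = clip (g 0) (g N) t - clip (g 0) (g N) s"
proof (induction N)
  case 0
  then show ?case by (simp add: clip_def)
next
  case (Suc N)
  have "g 0 \<le> g N"
    using lift_Suc_mono_le[of g 0 N] assms by simp
  then have "clip (g 0) (g N) x + clip (g N) (g (Suc N)) x = clip (g 0) (g (Suc N)) x + g N" for x
    using assms[of N] by (auto simp: clip_def)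
  from this[of s] this[of t] Suc show ?case by simp
qed

text \<open>The sum is the integral from \<open>s\<close> to \<open>t\<close> of the step function
  with values \<open>c i\<close>; a cell contributes only if it overlaps that segment, so only such
  coefficients are constrained.\<close>

lemma sum_clip_bound:
  assumes mono: "\<And>i. g i \<le> g (Suc i)"
    and c: "\<And>i. i < N \<Longrightarrow> clip (g i) (g (Suc i)) t \<noteq> clip (g i) (g (Suc i)) s \<Longrightarrow> \<bar>c i\<bar> \<le> \<rho>" and "0 \<le> \<rho>"
  shows "\<bar>\<Sum>i<N. c i * (clip (g i) (g (Suc i)) t - clip (g i) (g (Suc i)) s)\<bar> \<le> \<rho> * \<bar>t - s\<bar>"
proof -
  have le: "\<bar>\<Sum>i<N. c i * (clip (g i) (g (Suc i)) t - clip (g i) (g (Suc i)) s)\<bar> \<le> \<rho> * \<bar>t - s\<bar>"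
    if st: "s \<le> t" and c: "\<And>i. i < N \<Longrightarrow> clip (g i) (g (Suc i)) t \<noteq> clip (g i) (g (Suc i)) s \<Longrightarrow> \<bar>c i\<bar> \<le> \<rho>"
    for s t
  proof -
  have "\<bar>\<Sum>i<N. c i * (clip (g i) (g (Suc i)) t - clip (g i) (g (Suc i)) s)\<bar>
      \<le> (\<Sum>i<N. \<bar>c i\<bar> * (clip (g i) (g (Suc i)) t - clip (g i) (g (Suc i)) s))"
    using clip_mono[OF st] by (intro order_trans[OF sum_abs] sum_mono) (simp add: abs_mult)
  also have "\<dots> \<le> (\<Sum>i<N. \<rho> * (clip (g i) (g (Suc i)) t - clip (g i) (g (Suc i)) s))"
  proof (rule sum_mono)
    fix i assume "i \<in> {..<N}"
    then show "\<bar>c i\<bar> * (clip (g i) (g (Suc i)) t - clip (g i) (g (Suc i)) s)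
        \<le> \<rho> * (clip (g i) (g (Suc i)) t - clip (g i) (g (Suc i)) s)"
      using c[of i] clip_mono[OF st, of "g i" "g (Suc i)"]
      by (cases "clip (g i) (g (Suc i)) t = clip (g i) (g (Suc i)) s") (auto intro!: mult_right_mono)
  qed
  also have "\<dots> = \<rho> * (clip (g 0) (g N) t - clip (g 0) (g N) s)"
    unfolding sum_distrib_left[symmetric] sum_clip[of g, OF mono] ..
  also have "\<dots> \<le> \<rho> * \<bar>t - s\<bar>"
    using st \<open>0 \<le> \<rho>\<close> by (intro mult_left_mono) (auto simp: clip_def)
  finally show ?thesis .
  qed
  show ?thesis
  proof (cases "s \<le> t")
    case True
    then show ?thesis using c by (rule le)
  next
    case False
    have "(\<Sum>i<N. c i * (clip (g i) (g (Suc i)) t - clip (g i) (g (Suc i)) s))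
        = - (\<Sum>i<N. c i * (clip (g i) (g (Suc i)) s - clip (g i) (g (Suc i)) t))"
      unfolding sum_negf[symmetric] by (intro sum.cong) (simp_all add: algebra_simps)
    moreover have "\<bar>\<Sum>i<N. c i * (clip (g i) (g (Suc i)) s - clip (g i) (g (Suc i)) t)\<bar> \<le> \<rho> * \<bar>s - t\<bar>"
      using False c by (intro le) auto
    ultimately show ?thesis by (simp only: abs_minus_cancel abs_minus_commute)
  qed
qed

section \<open>Compactness of Lipschitz curves\<close>

text \<open>The invariant set of the Schauder argument. A fixed value at 0 and a common Lipschitz
  bound give compactness of the first \<open>m\<close> components under pointwise
  convergence.\<close>

definition lipschitz_curves :: "nat \<Rightarrow> (nat \<Rightarrow> real) \<Rightarrow> (nat \<Rightarrow> real) \<Rightarrow> (nat \<Rightarrow> real \<Rightarrow> real) set" where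
  "lipschitz_curves m \<xi> r = {x. \<forall>j<m. x j 0 = \<xi> j \<and> (\<forall>s t. \<bar>x j t - x j s\<bar> \<le> r j * \<bar>t - s\<bar>)}"

lemma lipschitz_curvesD:
  assumes "x \<in> lipschitz_curves m \<xi> r" "j < m"
  shows "x j 0 = \<xi> j" "\<bar>x j t - x j s\<bar> \<le> r j * \<bar>t - s\<bar>"
  using assms by (auto simp: lipschitz_curves_def)

lemma lipschitz_curves_limit:
  assumes "\<And>n. X n \<in> lipschitz_curves m \<xi> r" "\<And>j t. j < m \<Longrightarrow> (\<lambda>n. X n j t) \<longlonglongrightarrow> x j t"
  shows "x \<in> lipschitz_curves m \<xi> r"
  unfolding lipschitz_curves_def
proof (intro CollectI allI impI conjI)
  fix j assume j: "j < m"
  have "(\<lambda>n. X n j 0) = (\<lambda>n. \<xi> j)"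
    using lipschitz_curvesD(1)[OF assms(1) j] by simp
  then show "x j 0 = \<xi> j"
    using assms(2)[OF j, of 0] by (simp add: LIMSEQ_const_iff)
  fix s t
  have "(\<lambda>n. \<bar>X n j t - X n j s\<bar>) \<longlonglongrightarrow> \<bar>x j t - x j s\<bar>"
    by (intro tendsto_intros assms(2) j)
  then show "\<bar>x j t - x j s\<bar> \<le> r j * \<bar>t - s\<bar>"
    by (rule LIMSEQ_le_const2) (use lipschitz_curvesD(2)[OF assms(1) j] in auto)
qed

text \<open>Arzela-Ascoli: a diagonal subsequence converges at all rational times, and the common
  Lipschitz bound extends the convergence to real times.\<close>

lemma lipschitz_curves_compact:
  assumes r: "\<And>j. j < m \<Longrightarrow> 0 \<le> r j" and X: "\<And>n. X n \<in> lipschitz_curves m \<xi> r"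
  shows "\<exists>h x. strict_mono (h :: nat \<Rightarrow> nat) \<and> x \<in> lipschitz_curves m \<xi> r \<and>
    (\<forall>j<m. \<forall>t. (\<lambda>n. X (h n) j t) \<longlonglongrightarrow> x j t)"
proof -
  define S where "S = {..<m} \<times> (\<rat> :: real set)"
  \<comment> \<open>The diagonal argument takes one bound for all points; dividing by the growth
    bound of the curves turns it into 1.\<close>
  define b where "b z = 1 + \<bar>\<xi> (fst z)\<bar> + r (fst z) * \<bar>snd z\<bar>" for z :: "nat \<times> real"
  have b: "b z > 0" if "z \<in> S" for z
    using r[of "fst z"] that by (auto simp: b_def S_def intro!: add_pos_nonneg)
  define F where "F n z = X n (fst z) (snd z) / b z" for n z
  have "norm (F n z) \<le> 1" if "z \<in> S" for n z
    using lipschitz_curvesD(1)[OF X, of "fst z" n] lipschitz_curvesD(2)[OF X, of "fst z" n "snd z" 0] b[OF that] that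
    by (auto simp: F_def S_def divide_le_eq b_def)
  moreover have "countable S"
    by (simp add: S_def countable_rat)
  ultimately obtain h where h: "strict_mono (h :: nat \<Rightarrow> nat)" "\<And>z. z \<in> S \<Longrightarrow> \<exists>l. (\<lambda>n. F (h n) z) \<longlonglongrightarrow> l"
    using function_convergent_subsequence[of S F 1] by metis
  have conv_rat: "convergent (\<lambda>n. X (h n) j q)" if "j < m" "q \<in> \<rat>" for j q
  proof -
    have "(j, q) \<in> S" using that by (simp add: S_def)
    then obtain l where "(\<lambda>n. F (h n) (j, q)) \<longlonglongrightarrow> l" using h(2) by blast
    then have "(\<lambda>n. F (h n) (j, q) * b (j, q)) \<longlonglongrightarrow> l * b (j, q)"
      by (rule tendsto_mult_right)
    then show ?thesis
      using b[OF \<open>(j, q) \<in> S\<close>] by (auto simp: F_def convergent_def)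
  qed
  have conv: "convergent (\<lambda>n. X (h n) j t)" if j: "j < m" for j t
  proof -
    have "Cauchy (\<lambda>n. X (h n) j t)"
    proof (rule CauchyI')
      fix e :: real assume e: "0 < e"
      \<comment> \<open>Between \<open>t\<close> and a rational \<open>q\<close> this close every
        curve moves by less than \<open>e / 4\<close>; twice that plus \<open>e / 2\<close> at
        \<open>q\<close> makes \<open>e\<close>.\<close>
      have "t < t + e / (4 * (r j + 1))" using e r[OF j] by simp
      then obtain q where q: "q \<in> \<rat>" "t < q" "q < t + e / (4 * (r j + 1))"
        using Rats_dense_in_real by blast
      have "r j * \<bar>t - q\<bar> \<le> (r j + 1) * \<bar>t - q\<bar>"
        by (intro mult_right_mono) auto
      also have "\<dots> < e / 4"
        using q r[OF j] by (simp add: field_simps)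
      finally have rq: "r j * \<bar>t - q\<bar> < e / 4" .
      from conv_rat[OF j q(1)] have "Cauchy (\<lambda>n. X (h n) j q)"
        by (simp add: Cauchy_convergent_iff)
      then obtain N where N: "\<And>k l. k \<ge> N \<Longrightarrow> l \<ge> N \<Longrightarrow> \<bar>X (h k) j q - X (h l) j q\<bar> < e / 2"
        using e unfolding Cauchy_iff by (metis half_gt_zero real_norm_def)
      show "\<exists>N. \<forall>k\<ge>N. \<forall>l>k. dist (X (h k) j t) (X (h l) j t) < e"
      proof (intro exI[of _ N] allI impI)
        fix k l assume "k \<ge> N" "l > k"
        then show "dist (X (h k) j t) (X (h l) j t) < e"
          using N[of k l] rq lipschitz_curvesD(2)[OF X j, of "h k" t q] lipschitz_curvesD(2)[OF X j, of "h l" t q]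
          unfolding dist_real_def by linarith
      qed
    qed
    then show ?thesis by (simp add: Cauchy_convergent_iff)
  qed
  define x where "x j t = lim (\<lambda>n. X (h n) j t)" for j t
  have x: "(\<lambda>n. X (h n) j t) \<longlonglongrightarrow> x j t" if "j < m" for j t
    using conv[OF that] by (simp add: x_def convergent_LIMSEQ_iff)
  then show ?thesis
    using h(1) lipschitz_curves_limit[of "\<lambda>n. X (h n)"] X by blast
qed

section \<open>Existence by polygonal approximation\<close>

text \<open>\<open>G x j t\<close> may depend on the whole curve, past and future, which excludes
  stepping forward in time. The same \<open>r\<close> bounds \<open>G\<close> and the slopes of the
  curves, so prescribing slopes by \<open>G\<close> leads back into the set of curves.\<close>

locale functional_ode =
  fixes m :: nat and \<xi> r :: "nat \<Rightarrow> real" and M :: real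
    and G :: "(nat \<Rightarrow> real \<Rightarrow> real) \<Rightarrow> nat \<Rightarrow> real \<Rightarrow> real"
  assumes r: "\<And>j. j < m \<Longrightarrow> 0 \<le> r j" and M: "0 \<le> M"
    and bounded: "\<And>x j t. x \<in> lipschitz_curves m \<xi> r \<Longrightarrow> j < m \<Longrightarrow> \<bar>G x j t\<bar> \<le> r j"
    and lipschitz: "\<And>x j s t. x \<in> lipschitz_curves m \<xi> r \<Longrightarrow> j < m \<Longrightarrow> \<bar>G x j t - G x j s\<bar> \<le> M * \<bar>t - s\<bar>"
    and cont: "\<And>X x j t. (\<And>n. X n \<in> lipschitz_curves m \<xi> r) \<Longrightarrow> x \<in> lipschitz_curves m \<xi> r \<Longrightarrow>
      (\<And>j t. j < m \<Longrightarrow> (\<lambda>n. X n j t) \<longlonglongrightarrow> x j t) \<Longrightarrow> j < m \<Longrightarrow> (\<lambda>n. G (X n) j t) \<longlonglongrightarrow> G x j t"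
begin

text \<open>
  Piecewise linear curves on a grid of mesh \<open>1 / n\<close>, whose slope on each cell is prescribed by
  \<open>G\<close> at the left end point of the cell; the slopes solve a finite-dimensional fixed-point equation.
\<close>

lemma polygonal_approximation:
  assumes n: "0 < n"
  shows "\<exists>x \<in> lipschitz_curves m \<xi> r. \<forall>j<m. \<forall>s t. \<bar>s\<bar> \<le> real n \<longrightarrow> \<bar>t\<bar> \<le> real n \<longrightarrow>
    \<bar>x j t - x j s - G x j s * (t - s)\<bar> \<le> M * (\<bar>t - s\<bar> + 1 / real n) * \<bar>t - s\<bar>"
proof -
  \<comment> \<open>So many cells of width \<open>1 / n\<close> tile \<open>[-n, n]\<close>.\<close>
  define N where "N = 2 * n * n"
  define g where "g i = real i / real n - real n" for i
  \<comment> \<open>The slope of component \<open>j\<close> on cell \<open>i\<close> is entry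
    \<open>i * m + j\<close> of one vector of length \<open>N * m\<close>; \<open>f\<close> returns
    the slopes that \<open>G\<close> prescribes. Subtracting the clip at 0 fixes the initial
    value.\<close>
  define X where "X c j t = \<xi> j + (\<Sum>i<N. c (i * m + j) * (clip (g i) (g (Suc i)) t - clip (g i) (g (Suc i)) 0))" for c j t
  define f where "f c k = G (X c) (k mod m) (g (k div m))" for c k
  have mono: "g i \<le> g (Suc i)" for i
    using n by (simp add: g_def divide_right_mono)
  have idx: "i * m + j < N * m" if "i < N" "j < m" for i j
  proof -
    have "Suc i * m \<le> N * m" using that by (intro mult_right_mono) auto
    then show ?thesis using that by simp
  qed
  have X_diff: "X c j t - X c j s = (\<Sum>i<N. c (i * m + j) * (clip (g i) (g (Suc i)) t - clip (g i) (g (Suc i)) s))" for c j s t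
    by (simp add: X_def sum_subtractf[symmetric] right_diff_distrib)
  have X_lip: "X c \<in> lipschitz_curves m \<xi> r" if c: "\<forall>k<N*m. \<bar>c k\<bar> \<le> r (k mod m)" for c
    unfolding lipschitz_curves_def
  proof (intro CollectI allI impI conjI)
    fix j s t assume j: "j < m"
    show "X c j 0 = \<xi> j" by (simp add: X_def)
    show "\<bar>X c j t - X c j s\<bar> \<le> r j * \<bar>t - s\<bar>"
      unfolding X_diff
    proof (rule sum_clip_bound[of g, OF mono])
      show "\<bar>c (i * m + j)\<bar> \<le> r j" if "i < N" for i
        using c[rule_format, OF idx[OF that j]] j by simp
    qed (rule r[OF j])
  qed
  have mpos: "k mod m < m" if "k < N * m" for k
    using that by (cases m) auto
  have "\<exists>c. \<forall>k<N*m. \<bar>c k\<bar> \<le> r (k mod m) \<and> f c k = c k"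
  proof (rule box_fixed_point)
    show "0 \<le> r (k mod m)" if "k < N * m" for k
      using r mpos that by blast
    show "\<bar>f c k\<bar> \<le> r (k mod m)" if "\<forall>k<N*m. \<bar>c k\<bar> \<le> r (k mod m)" "k < N * m" for c k
      unfolding f_def using that by (intro bounded X_lip mpos)
  next
    fix C :: "nat \<Rightarrow> nat \<Rightarrow> real" and c k
    assume C: "\<forall>l. \<forall>k<N*m. \<bar>C l k\<bar> \<le> r (k mod m)" "\<forall>k<N*m. (\<lambda>l. C l k) \<longlonglongrightarrow> c k" and k: "k < N * m"
    have lim: "(\<lambda>l. X (C l) j t) \<longlonglongrightarrow> X c j t" if "j < m" for j t
      unfolding X_def using C(2) idx that by (intro tendsto_intros) auto
    have XC: "X (C l) \<in> lipschitz_curves m \<xi> r" for l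
      using C(1) by (intro X_lip) blast
    show "(\<lambda>l. f (C l) k) \<longlonglongrightarrow> f c k"
      unfolding f_def by (rule cont[OF XC lipschitz_curves_limit[OF XC lim] lim mpos[OF k]])
  qed
  then obtain c where c: "\<And>k. k < N * m \<Longrightarrow> \<bar>c k\<bar> \<le> r (k mod m)" "\<And>k. k < N * m \<Longrightarrow> f c k = c k"
    by blast
  have Xc: "X c \<in> lipschitz_curves m \<xi> r" using c X_lip by blast
  have g0: "g 0 = - real n" and gN: "g N = real n"
    using n by (simp_all add: g_def N_def)
  have "\<bar>X c j t - X c j s - G (X c) j s * (t - s)\<bar> \<le> M * (\<bar>t - s\<bar> + 1 / real n) * \<bar>t - s\<bar>"
    if j: "j < m" and st: "\<bar>s\<bar> \<le> real n" "\<bar>t\<bar> \<le> real n" for j s t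
  proof -
    have "t - s = clip (g 0) (g N) t - clip (g 0) (g N) s"
      using st by (simp add: clip_def g0 gN abs_le_iff)
    also have "\<dots> = (\<Sum>i<N. clip (g i) (g (Suc i)) t - clip (g i) (g (Suc i)) s)"
      by (rule sum_clip[of g, OF mono, symmetric])
    finally have ts: "t - s = (\<Sum>i<N. clip (g i) (g (Suc i)) t - clip (g i) (g (Suc i)) s)" .
    have "G (X c) j s * (t - s) = (\<Sum>i<N. G (X c) j s * (clip (g i) (g (Suc i)) t - clip (g i) (g (Suc i)) s))"
      by (subst ts) (simp add: sum_distrib_left)
    \<comment> \<open>The error is the integral of a step function: slope of the cell minus
      \<open>G\<close> at time \<open>s\<close>.\<close>
    then have "X c j t - X c j s - G (X c) j s * (t - s) =
        (\<Sum>i<N. (c (i * m + j) - G (X c) j s) * (clip (g i) (g (Suc i)) t - clip (g i) (g (Suc i)) s))"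
      unfolding X_diff by (simp only: sum_subtractf[symmetric] left_diff_distrib)
    also have "\<bar>\<dots>\<bar> \<le> M * (\<bar>t - s\<bar> + 1 / real n) * \<bar>t - s\<bar>"
    proof (rule sum_clip_bound[of g, OF mono])
      fix i assume i: "i < N" and ne: "clip (g i) (g (Suc i)) t \<noteq> clip (g i) (g (Suc i)) s"
      have "c (i * m + j) = G (X c) j (g i)"
        using c(2)[OF idx[OF i j]] j by (simp add: f_def)
      then have *: "\<bar>c (i * m + j) - G (X c) j s\<bar> \<le> M * \<bar>g i - s\<bar>"
        using lipschitz[OF Xc j] by simp
      have "g (Suc i) = g i + 1 / real n"
        using n by (simp add: g_def add_divide_distrib)
      \<comment> \<open>A contributing cell meets the segment between \<open>s\<close> and
        \<open>t\<close>, so its left end is at most one mesh width farther from \<open>s\<close>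
        than \<open>t\<close> is.\<close>
      moreover have "s > g i \<or> t > g i" "s < g (Suc i) \<or> t < g (Suc i)"
        using ne mono[of i] by (auto simp: clip_def)
      ultimately have "\<bar>g i - s\<bar> \<le> \<bar>t - s\<bar> + 1 / real n"
        using mono[of i] by (elim disjE; linarith)
      then have "M * \<bar>g i - s\<bar> \<le> M * (\<bar>t - s\<bar> + 1 / real n)"
        using M by (rule mult_left_mono)
      with * show "\<bar>c (i * m + j) - G (X c) j s\<bar> \<le> M * (\<bar>t - s\<bar> + 1 / real n)"
        by linarith
    qed (use M in simp)
    finally show ?thesis .
  qed
  then show ?thesis using Xc by blast
qed

text \<open>Along a convergent subsequence of polygonal curves the mesh term vanishes. The remaining
  error is quadratic in \<open>t - s\<close>, which gives the derivative.\<close>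

lemma existence:
  "\<exists>x \<in> lipschitz_curves m \<xi> r. \<forall>j<m. \<forall>t. (x j has_real_derivative G x j t) (at t)"
proof -
  have "\<forall>n. \<exists>x. x \<in> lipschitz_curves m \<xi> r \<and> (\<forall>j<m. \<forall>s t. \<bar>s\<bar> \<le> real (Suc n) \<longrightarrow> \<bar>t\<bar> \<le> real (Suc n) \<longrightarrow>
    \<bar>x j t - x j s - G x j s * (t - s)\<bar> \<le> M * (\<bar>t - s\<bar> + 1 / real (Suc n)) * \<bar>t - s\<bar>)"
    using polygonal_approximation[OF zero_less_Suc] by blast
  then obtain X where X: "\<And>n. X n \<in> lipschitz_curves m \<xi> r"
    and approx: "\<And>n j s t. j < m \<Longrightarrow> \<bar>s\<bar> \<le> real (Suc n) \<Longrightarrow> \<bar>t\<bar> \<le> real (Suc n) \<Longrightarrow>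
    \<bar>X n j t - X n j s - G (X n) j s * (t - s)\<bar> \<le> M * (\<bar>t - s\<bar> + 1 / real (Suc n)) * \<bar>t - s\<bar>"
    by metis
  obtain h x where h: "strict_mono (h :: nat \<Rightarrow> nat)" and x: "x \<in> lipschitz_curves m \<xi> r"
    and lim: "\<And>j t. j < m \<Longrightarrow> (\<lambda>n. X (h n) j t) \<longlonglongrightarrow> x j t"
    using lipschitz_curves_compact[of m r X \<xi>] r X by blast
  have bound: "\<bar>x j t - x j s - G x j s * (t - s)\<bar> \<le> M * (\<bar>t - s\<bar> + 0) * \<bar>t - s\<bar>" if j: "j < m" for j s t
  proof (rule LIMSEQ_le)
    show "(\<lambda>n. \<bar>X (h n) j t - X (h n) j s - G (X (h n)) j s * (t - s)\<bar>) \<longlonglongrightarrow> \<bar>x j t - x j s - G x j s * (t - s)\<bar>"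
      by (intro tendsto_intros lim cont X x j)
    have "(\<lambda>n. 1 / real (Suc (h n))) \<longlonglongrightarrow> 0"
      using LIMSEQ_subseq_LIMSEQ[OF LIMSEQ_Suc[OF lim_const_over_n[of "1 :: real"]] h] by (simp add: o_def)
    then show "(\<lambda>n. M * (\<bar>t - s\<bar> + 1 / real (Suc (h n))) * \<bar>t - s\<bar>) \<longlonglongrightarrow> M * (\<bar>t - s\<bar> + 0) * \<bar>t - s\<bar>"
      by (intro tendsto_intros)
    \<comment> \<open>Each approximation is controlled on a bounded interval only, so the estimate
      holds once that interval contains \<open>s\<close> and \<open>t\<close>.\<close>
    obtain K where K: "max \<bar>s\<bar> \<bar>t\<bar> \<le> real K" using real_arch_simple by blast
    have "\<bar>X (h n) j t - X (h n) j s - G (X (h n)) j s * (t - s)\<bar> \<le> M * (\<bar>t - s\<bar> + 1 / real (Suc (h n))) * \<bar>t - s\<bar>"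
      if "n \<ge> K" for n
      using K that seq_suble[OF h, of n] by (intro approx j) auto
    then show "\<exists>K. \<forall>n\<ge>K. \<bar>X (h n) j t - X (h n) j s - G (X (h n)) j s * (t - s)\<bar> \<le> M * (\<bar>t - s\<bar> + 1 / real (Suc (h n))) * \<bar>t - s\<bar>"
      by blast
  qed
  have "(x j has_real_derivative G x j s) (at s)" if j: "j < m" for j s
    unfolding has_field_derivative_iff
  proof -
    have "((\<lambda>t. (x j t - x j s) / (t - s) - G x j s) \<longlongrightarrow> 0) (at s)"
    proof (rule Lim_null_comparison)
      have "((\<lambda>t. M * \<bar>t - s\<bar>) \<longlongrightarrow> M * \<bar>s - s\<bar>) (at s)"
        by (intro tendsto_intros)
      then show "((\<lambda>t. M * \<bar>t - s\<bar>) \<longlongrightarrow> 0) (at s)" by simp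
      have "norm ((x j t - x j s) / (t - s) - G x j s) \<le> M * \<bar>t - s\<bar>" if "t \<noteq> s" for t
      proof -
        have "(x j t - x j s) / (t - s) - G x j s = (x j t - x j s - G x j s * (t - s)) / (t - s)"
          using that by (simp add: diff_divide_distrib)
        then show ?thesis
          using bound[OF j, of t s] that by (simp add: divide_le_eq)
      qed
      then show "\<forall>\<^sub>F t in at s. norm ((x j t - x j s) / (t - s) - G x j s) \<le> M * \<bar>t - s\<bar>"
        by (auto simp: eventually_at_filter)
    qed
    then show "((\<lambda>t. (x j t - x j s) / (t - s)) \<longlongrightarrow> G x j s) (at s)"
      by (simp add: LIM_zero_iff)
  qed
  then show ?thesis using x by blast
qed

end

section \<open>The truncated equations of motion\<close>

definition speed :: "real \<Rightarrow> real" where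
  "speed p = p / sqrt (1 + p\<^sup>2)"

text \<open>For unit mass and unit speed of light; the inverse of \<open>speed\<close>. With momenta
  as unknowns, velocities stay below the speed of light automatically.\<close>

definition momentum :: "real \<Rightarrow> real" where
  "momentum u = u / sqrt (1 - u\<^sup>2)"

lemma one_plus_square_pos [simp]: "0 < 1 + (p::real)\<^sup>2"
  by (simp add: add_pos_nonneg)

lemma one_plus_square_nonzero [simp]: "1 + (p::real)\<^sup>2 \<noteq> 0"
  using one_plus_square_pos[of p] by linarith

lemma speed_bounded: "\<bar>speed p\<bar> < 1"
proof -
  have "\<bar>p\<bar> < sqrt (1 + p\<^sup>2)"
    by (rule real_less_rsqrt) simp
  then show ?thesis by (simp add: speed_def divide_less_eq)
qed

lemma speed_minus [simp]: "speed (- p) = - speed p"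
  by (simp add: speed_def)

lemma momentum_speed: "momentum (speed p) = p"
proof -
  have "1 - (speed p)\<^sup>2 = 1 / (1 + p\<^sup>2)"
    by (simp add: speed_def power_divide field_simps add_nonneg_eq_0_iff)
  then show ?thesis
    by (simp add: momentum_def speed_def real_sqrt_divide)
qed

lemma speed_momentum:
  assumes "\<bar>u\<bar> < 1"
  shows "speed (momentum u) = u"
proof -
  have pos: "0 < 1 - u\<^sup>2" using assms by (simp add: abs_square_less_1)
  then have "1 + (momentum u)\<^sup>2 = 1 / (1 - u\<^sup>2)"
    by (simp add: momentum_def power_divide field_simps)
  then show ?thesis
    using pos by (simp add: momentum_def speed_def real_sqrt_divide)
qed

lemma DERIV_speed: "(speed has_real_derivative (1 / sqrt (1 + p\<^sup>2)) ^ 3) (at p)"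
proof -
  define w where "w = sqrt (1 + p\<^sup>2)"
  have w: "0 < w" "w\<^sup>2 = 1 + p\<^sup>2"
    by (simp_all add: w_def add_nonneg_nonneg)
  have "((\<lambda>p. p / sqrt (1 + p\<^sup>2)) has_real_derivative (w - p * (p / w)) / w\<^sup>2) (at p)"
    by (auto intro!: derivative_eq_intros simp: w_def field_simps power2_eq_square add_nonneg_eq_0_iff)
      (use one_plus_square_pos[of p] in \<open>simp add: power2_eq_square\<close>)
  moreover have "(w - p * (p / w)) / w\<^sup>2 = (w\<^sup>2 - p\<^sup>2) / w ^ 3"
    using w(1) by (simp add: field_simps power2_eq_square power3_eq_cube)
  ultimately show ?thesis
    unfolding speed_def w_def[symmetric] by (simp add: w(2) power_divide)
qed

lemma strict_mono_speed: "strict_mono speed"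
proof (rule strict_monoI)
  fix p q :: real assume "p < q"
  then show "speed p < speed q"
    by (rule DERIV_pos_imp_increasing) (use DERIV_speed in \<open>auto intro!: exI\<close>)
qed

lemma speed_lipschitz: "\<bar>speed p - speed q\<bar> \<le> \<bar>p - q\<bar>"
proof -
  have "\<bar>speed p - speed q\<bar> \<le> 1 * \<bar>p - q\<bar>"
  proof (rule field_differentiable_bound[of UNIV speed "\<lambda>p. (1 / sqrt (1 + p\<^sup>2)) ^ 3", unfolded real_norm_def])
    show "\<bar>(1 / sqrt (1 + x\<^sup>2)) ^ 3\<bar> \<le> 1" for x :: real
      by (simp add: power_le_one)
  qed (use DERIV_speed in auto)
  then show ?thesis by simp
qed

section \<open>Delays as fixed points of contractions\<close>

text \<open>Here \<open>f\<close> is the other trajectory with its sign flipped, so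
  \<open>x + f\<close> is a signed distance. The advanced delay has \<open>\<sigma> = 1\<close>, the
  retarded one \<open>\<sigma> = - 1\<close>. Without an absolute value the solution may be
  negative; positivity comes from \<open>delay_ge\<close>.\<close>

definition delay :: "real \<Rightarrow> (real \<Rightarrow> real) \<Rightarrow> real \<Rightarrow> real \<Rightarrow> real" where
  "delay \<sigma> f x t = (THE s. s = x + f (t + \<sigma> * s))"

context
  fixes V \<sigma> :: real and f :: "real \<Rightarrow> real"
  assumes V: "V < 1" and \<sigma>: "\<bar>\<sigma>\<bar> = 1" and lip: "\<And>s t. \<bar>f t - f s\<bar> \<le> V * \<bar>t - s\<bar>"
begin

text \<open>By the speed bound the right-hand side is a contraction in \<open>s\<close> with factor
  \<open>V\<close>.\<close>

lemma delay_ex1: "\<exists>!s. s = x + f (t + \<sigma> * s)"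
proof -
  have V0: "0 \<le> V" using lip[of 1 0] by auto
  have "dist (x + f (t + \<sigma> * s)) (x + f (t + \<sigma> * s')) \<le> V * dist s s'" for s s'
    using lip[of "t + \<sigma> * s" "t + \<sigma> * s'"] \<sigma>
    by (simp add: dist_real_def right_diff_distrib[symmetric] abs_mult)
  then have "\<exists>!s. x + f (t + \<sigma> * s) = s"
    by (intro banach_fix_type[OF V0 V]) blast
  then show ?thesis by (simp add: eq_commute)
qed

lemma delay_eq: "delay \<sigma> f x t = x + f (t + \<sigma> * delay \<sigma> f x t)"
  unfolding delay_def by (rule theI'[OF delay_ex1])

text \<open>Stability of the fixed point of a contraction under changes of position, time and
  trajectory. The two trajectories are compared at one point only, the contact time of
  \<open>s'\<close>.\<close>

lemma delay_diff:
  assumes s': "s' = y + g (u + \<sigma> * s')"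
  shows "(1 - V) * \<bar>delay \<sigma> f x t - s'\<bar> \<le> \<bar>x - y\<bar> + V * \<bar>t - u\<bar> + \<bar>f (u + \<sigma> * s') - g (u + \<sigma> * s')\<bar>"
proof -
  define s where "s = delay \<sigma> f x t"
  have s: "s = x + f (t + \<sigma> * s)" unfolding s_def by (rule delay_eq)
  have V0: "0 \<le> V" using lip[of 1 0] by auto
  have "\<bar>(t + \<sigma> * s) - (u + \<sigma> * s')\<bar> \<le> \<bar>t - u\<bar> + \<bar>\<sigma> * (s - s')\<bar>"
    by (simp add: right_diff_distrib)
  also have "\<dots> = \<bar>t - u\<bar> + \<bar>s - s'\<bar>" by (simp add: abs_mult \<sigma>)
  finally have "V * \<bar>(t + \<sigma> * s) - (u + \<sigma> * s')\<bar> \<le> V * (\<bar>t - u\<bar> + \<bar>s - s'\<bar>)"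
    using V0 by (rule mult_left_mono)
  moreover have "s - s' = (x - y) + (f (t + \<sigma> * s) - f (u + \<sigma> * s')) + (f (u + \<sigma> * s') - g (u + \<sigma> * s'))"
    using s s' by linarith
  ultimately have "\<bar>s - s'\<bar> \<le> \<bar>x - y\<bar> + V * (\<bar>t - u\<bar> + \<bar>s - s'\<bar>) + \<bar>f (u + \<sigma> * s') - g (u + \<sigma> * s')\<bar>"
    using lip[of "t + \<sigma> * s" "u + \<sigma> * s'"] by linarith
  then show ?thesis
    unfolding s_def[symmetric] by (simp add: algebra_simps)
qed

end

section \<open>The truncated force\<close>

text \<open>Equal to the Coulomb force for \<open>s \<ge> \<epsilon>\<close>, but bounded and
  Lipschitz on the whole line, negative delays included.\<close>

definition coulomb :: "real \<Rightarrow> real \<Rightarrow> real" where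
  "coulomb \<epsilon> s = 1 / (max s \<epsilon>)\<^sup>2"

definition force :: "real \<Rightarrow> (real \<Rightarrow> real) \<Rightarrow> real \<Rightarrow> real \<Rightarrow> real" where
  "force \<epsilon> f x t = coulomb \<epsilon> (delay 1 f x t) + coulomb \<epsilon> (delay (- 1) f x t)"

lemma coulomb_nonneg: "0 \<le> coulomb \<epsilon> s"
  by (simp add: coulomb_def)

lemma coulomb_le: "0 < \<epsilon> \<Longrightarrow> coulomb \<epsilon> s \<le> 1 / \<epsilon>\<^sup>2"
  by (auto simp: coulomb_def intro!: divide_left_mono power_mono)

lemma force_nonneg: "0 \<le> force \<epsilon> f x t"
  by (simp add: force_def coulomb_nonneg)

lemma force_le: "0 < \<epsilon> \<Longrightarrow> force \<epsilon> f x t \<le> 2 / \<epsilon>\<^sup>2"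
  using coulomb_le[of \<epsilon> "delay 1 f x t"] coulomb_le[of \<epsilon> "delay (- 1) f x t"] by (simp add: force_def)

lemma coulomb_lipschitz:
  assumes "0 < \<epsilon>"
  shows "\<bar>coulomb \<epsilon> s - coulomb \<epsilon> s'\<bar> \<le> 2 / \<epsilon> ^ 3 * \<bar>s - s'\<bar>"
proof -
  define X Y where "X = max s \<epsilon>" and "Y = max s' \<epsilon>"
  have XY: "\<epsilon> \<le> X" "\<epsilon> \<le> Y" "\<bar>X - Y\<bar> \<le> \<bar>s - s'\<bar>"
    by (auto simp: X_def Y_def)
  then have pos: "0 < X" "0 < Y" using assms by auto
  have "coulomb \<epsilon> s - coulomb \<epsilon> s' = (1 / (X * Y\<^sup>2) + 1 / (X\<^sup>2 * Y)) * (Y - X)"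
    unfolding coulomb_def X_def[symmetric] Y_def[symmetric]
    using pos by (simp add: field_simps power2_eq_square)
  then have "\<bar>coulomb \<epsilon> s - coulomb \<epsilon> s'\<bar> = (1 / (X * Y\<^sup>2) + 1 / (X\<^sup>2 * Y)) * \<bar>X - Y\<bar>"
    using pos by (simp add: abs_mult abs_minus_commute)
  also have "\<dots> \<le> (1 / (\<epsilon> * \<epsilon>\<^sup>2) + 1 / (\<epsilon>\<^sup>2 * \<epsilon>)) * \<bar>s - s'\<bar>"
    using XY assms pos by (intro mult_mono add_mono divide_left_mono mult_mono power_mono) auto
  also have "\<dots> = 2 / \<epsilon> ^ 3 * \<bar>s - s'\<bar>"
    by (simp add: power2_eq_square power3_eq_cube)
  finally show ?thesis .
qed

lemma delay_lipschitz:
  assumes V: "V < 1" and \<sigma>: "\<bar>\<sigma>\<bar> = 1"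
    and f: "\<And>s t. \<bar>f t - f s\<bar> \<le> V * \<bar>t - s\<bar>" and g: "\<And>s t. \<bar>g t - g s\<bar> \<le> V * \<bar>t - s\<bar>"
  shows "\<bar>delay \<sigma> f (g t) t - delay \<sigma> f (g s) s\<bar> \<le> 2 / (1 - V) * \<bar>t - s\<bar>"
proof -
  have "(1 - V) * \<bar>delay \<sigma> f (g t) t - delay \<sigma> f (g s) s\<bar> \<le> \<bar>g t - g s\<bar> + V * \<bar>t - s\<bar>"
    using delay_diff[of V \<sigma> f "delay \<sigma> f (g s) s" "g s" f s "g t" t, OF V \<sigma> f delay_eq[of V \<sigma> f, OF V \<sigma> f]] by simp
  also have "\<dots> \<le> 1 * \<bar>t - s\<bar> + 1 * \<bar>t - s\<bar>"
    using V by (intro add_mono order_trans[OF g] mult_right_mono) auto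
  finally show ?thesis
    using V by (simp add: field_simps)
qed

lemma force_lipschitz:
  assumes \<epsilon>: "0 < \<epsilon>" and V: "V < 1"
    and f: "\<And>s t. \<bar>f t - f s\<bar> \<le> V * \<bar>t - s\<bar>" and g: "\<And>s t. \<bar>g t - g s\<bar> \<le> V * \<bar>t - s\<bar>"
  shows "\<bar>force \<epsilon> f (g t) t - force \<epsilon> f (g s) s\<bar> \<le> 8 / (\<epsilon> ^ 3 * (1 - V)) * \<bar>t - s\<bar>"
proof -
  have *: "\<bar>coulomb \<epsilon> (delay \<sigma> f (g t) t) - coulomb \<epsilon> (delay \<sigma> f (g s) s)\<bar> \<le> 4 / (\<epsilon> ^ 3 * (1 - V)) * \<bar>t - s\<bar>"
    if \<sigma>: "\<bar>\<sigma>\<bar> = 1" for \<sigma>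
  proof -
    have "\<bar>coulomb \<epsilon> (delay \<sigma> f (g t) t) - coulomb \<epsilon> (delay \<sigma> f (g s) s)\<bar> \<le> 2 / \<epsilon> ^ 3 * (2 / (1 - V) * \<bar>t - s\<bar>)"
      using \<epsilon> by (intro order_trans[OF coulomb_lipschitz[OF \<epsilon>]] mult_left_mono delay_lipschitz[of V \<sigma> f g, OF V \<sigma> f g]) auto
    then show ?thesis by simp
  qed
  show ?thesis
  proof -
    define z where "z = 4 / (\<epsilon> ^ 3 * (1 - V)) * \<bar>t - s\<bar>"
    have "8 / (\<epsilon> ^ 3 * (1 - V)) * \<bar>t - s\<bar> = z + z" by (simp add: z_def)
    then show ?thesis
      using *[of 1] *[of "- 1"] unfolding force_def z_def[symmetric] by simp
  qed
qed

text \<open>Pointwise convergence of the trajectories suffices, because \<open>delay_diff\<close> is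
  applied at the contact time of the limit.\<close>

lemma tendsto_delay:
  assumes V: "V < 1" and \<sigma>: "\<bar>\<sigma>\<bar> = 1"
    and F: "\<And>n s t. \<bar>F n t - F n s\<bar> \<le> V * \<bar>t - s\<bar>" and f: "\<And>s t. \<bar>f t - f s\<bar> \<le> V * \<bar>t - s\<bar>"
    and lim: "\<And>t. (\<lambda>n. F n t) \<longlonglongrightarrow> f t" and x: "X \<longlonglongrightarrow> x"
  shows "(\<lambda>n. delay \<sigma> (F n) (X n) t) \<longlonglongrightarrow> delay \<sigma> f x t"
proof -
  define s where "s = delay \<sigma> f x t"
  have s: "s = x + f (t + \<sigma> * s)" unfolding s_def by (rule delay_eq[of V \<sigma> f, OF V \<sigma> f])
  define e where "e n = (\<bar>X n - x\<bar> + \<bar>F n (t + \<sigma> * s) - f (t + \<sigma> * s)\<bar>) / (1 - V)" for n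
  have "e \<longlonglongrightarrow> (\<bar>x - x\<bar> + \<bar>f (t + \<sigma> * s) - f (t + \<sigma> * s)\<bar>) / (1 - V)"
    unfolding e_def using V by (intro tendsto_intros lim x) auto
  then have e0: "e \<longlonglongrightarrow> 0" by simp
  have e: "norm (delay \<sigma> (F n) (X n) t - s) \<le> e n" for n
    using delay_diff[of V \<sigma> "F n" s x f t "X n" t, OF V \<sigma> F s] V by (simp add: e_def field_simps)
  have "(\<lambda>n. delay \<sigma> (F n) (X n) t - s) \<longlonglongrightarrow> 0"
    by (rule Lim_null_comparison[OF always_eventually e0]) (use e in blast)
  then show ?thesis by (simp add: s_def LIM_zero_iff)
qed

lemma tendsto_force:
  assumes \<epsilon>: "0 < \<epsilon>" and V: "V < 1"
    and F: "\<And>n s t. \<bar>F n t - F n s\<bar> \<le> V * \<bar>t - s\<bar>" and f: "\<And>s t. \<bar>f t - f s\<bar> \<le> V * \<bar>t - s\<bar>"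
    and lim: "\<And>t. (\<lambda>n. F n t) \<longlonglongrightarrow> f t" and x: "X \<longlonglongrightarrow> x"
  shows "(\<lambda>n. force \<epsilon> (F n) (X n) t) \<longlonglongrightarrow> force \<epsilon> f x t"
  unfolding force_def coulomb_def
  by (intro tendsto_intros tendsto_delay[of V _ F f, OF V _ F f lim x]) (use \<epsilon> in auto)

lemma truncated_existence:
  fixes A0 B0 p0 q0 \<epsilon> Q :: real
  assumes \<epsilon>: "0 < \<epsilon>" and Q: "0 < Q"
  shows "\<exists>A B p q. A 0 = A0 \<and> B 0 = B0 \<and> p 0 = p0 \<and> q 0 = q0 \<and>
    (\<forall>t. (A has_real_derivative speed (clip (- Q) Q (p t))) (at t)) \<and>
    (\<forall>t. (B has_real_derivative speed (clip (- Q) Q (q t))) (at t)) \<and>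
    (\<forall>t. (p has_real_derivative force \<epsilon> B (A t) t) (at t)) \<and>
    (\<forall>t. (q has_real_derivative force \<epsilon> A (B t) t) (at t))"
proof -
  \<comment> \<open>The largest speed that clipped momenta allow; being below 1, it makes the delay
    equations contractions.\<close>
  define V where "V = speed Q"
  have V: "V < 1" "0 < V"
    using speed_bounded[of Q] Q by (auto simp: V_def speed_def)
  \<comment> \<open>Components 0 and 1 are the positions, 2 and 3 the momenta.\<close>
  define \<xi> where "\<xi> = (\<lambda>j::nat. if j = 0 then A0 else if j = 1 then B0 else if j = 2 then p0 else q0)"
  define r where "r = (\<lambda>j::nat. if j = 0 \<or> j = 1 then V else 2 / \<epsilon>\<^sup>2)"
  \<comment> \<open>The first term is the Lipschitz constant of the momenta, inherited by the
    velocities; the second is that of the force.\<close>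
  define M where "M = 2 / \<epsilon>\<^sup>2 + 8 / (\<epsilon> ^ 3 * (1 - V))"
  define G where "G = (\<lambda>x (j::nat) t. if j = 0 then speed (clip (- Q) Q (x 2 t))
    else if j = 1 then speed (clip (- Q) Q (x (3::nat) t))
    else if j = 2 then force \<epsilon> (x 1) (x 0 t) t else force \<epsilon> (x 0) (x 1 t) t)"
  let ?K = "lipschitz_curves 4 \<xi> r"
  have K: "\<And>s t. \<bar>x 0 t - x 0 s\<bar> \<le> V * \<bar>t - s\<bar>" "\<And>s t. \<bar>x 1 t - x 1 s\<bar> \<le> V * \<bar>t - s\<bar>"
    "\<And>s t. \<bar>x 2 t - x 2 s\<bar> \<le> 2 / \<epsilon>\<^sup>2 * \<bar>t - s\<bar>" "\<And>s t. \<bar>x 3 t - x 3 s\<bar> \<le> 2 / \<epsilon>\<^sup>2 * \<bar>t - s\<bar>"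
    if "x \<in> ?K" for x
    using lipschitz_curvesD(2)[OF that, of 0] lipschitz_curvesD(2)[OF that, of 1]
      lipschitz_curvesD(2)[OF that, of 2] lipschitz_curvesD(2)[OF that, of 3]
    by (simp_all add: r_def)
  have speed_clip: "\<bar>speed (clip (- Q) Q y)\<bar> \<le> V" for y
  proof -
    have "speed (- Q) \<le> speed (clip (- Q) Q y)" "speed (clip (- Q) Q y) \<le> speed Q"
      using Q by (simp_all only: strict_mono_less_eq[OF strict_mono_speed]) (auto simp: clip_def)
    then show ?thesis by (simp add: V_def)
  qed
  have clip_lip: "\<bar>speed (clip (- Q) Q y) - speed (clip (- Q) Q z)\<bar> \<le> \<bar>y - z\<bar>" for y z
    by (rule order_trans[OF speed_lipschitz]) (use Q in \<open>auto simp: clip_def\<close>)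
  have M1: "2 / \<epsilon>\<^sup>2 * \<bar>t - s\<bar> \<le> M * \<bar>t - s\<bar>" "8 / (\<epsilon> ^ 3 * (1 - V)) * \<bar>t - s\<bar> \<le> M * \<bar>t - s\<bar>" for s t :: real
    unfolding M_def using V \<epsilon> by (intro mult_right_mono; simp)+
  have four: "j = 0 \<or> j = 1 \<or> j = 2 \<or> j = 3" if "j < 4" for j :: nat
    using that by auto
  interpret functional_ode 4 \<xi> r M G
  proof
    show "0 \<le> r j" for j using V by (simp add: r_def)
    show "0 \<le> M" using V \<epsilon> by (simp add: M_def)
    show "\<bar>G x j t\<bar> \<le> r j" for x j t
      using speed_clip force_nonneg force_le[OF \<epsilon>] by (auto simp: G_def r_def abs_of_nonneg)
    show "\<bar>G x j t - G x j s\<bar> \<le> M * \<bar>t - s\<bar>" if x: "x \<in> ?K" and j: "j < 4" for x j s t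
    proof -
      note K = K[OF x]
      have "\<bar>G x 0 t - G x 0 s\<bar> \<le> M * \<bar>t - s\<bar>" "\<bar>G x 1 t - G x 1 s\<bar> \<le> M * \<bar>t - s\<bar>"
        using order_trans[OF clip_lip order_trans[OF K(3) M1(1)]] order_trans[OF clip_lip order_trans[OF K(4) M1(1)]]
        by (simp_all add: G_def)
      moreover have "\<bar>G x 2 t - G x 2 s\<bar> \<le> M * \<bar>t - s\<bar>" "\<bar>G x 3 t - G x 3 s\<bar> \<le> M * \<bar>t - s\<bar>"
        using order_trans[OF force_lipschitz[of \<epsilon> V "x 1" "x 0", OF \<epsilon> V(1) K(2) K(1)] M1(2)]
          order_trans[OF force_lipschitz[of \<epsilon> V "x 0" "x 1", OF \<epsilon> V(1) K(1) K(2)] M1(2)]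
        by (simp_all add: G_def)
      ultimately show ?thesis using four[OF j] by blast
    qed
    show "(\<lambda>n. G (X n) j t) \<longlonglongrightarrow> G x j t"
      if X: "\<And>n. X n \<in> ?K" and x: "x \<in> ?K" and lim: "\<And>j t. j < 4 \<Longrightarrow> (\<lambda>n. X n j t) \<longlonglongrightarrow> x j t" and j: "j < 4"
      for X x j t
    proof -
      have speed: "(\<lambda>n. speed (clip (- Q) Q (X n i t))) \<longlonglongrightarrow> speed (clip (- Q) Q (x i t))" if "i < 4" for i
        unfolding clip_def speed_def
        by (intro tendsto_intros lim that) (simp add: add_nonneg_eq_0_iff)
      have "(\<lambda>n. G (X n) 0 t) \<longlonglongrightarrow> G x 0 t" "(\<lambda>n. G (X n) 1 t) \<longlonglongrightarrow> G x 1 t"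
        using speed[of 2] speed[of 3] by (simp_all add: G_def)
      moreover have "(\<lambda>n. G (X n) 2 t) \<longlonglongrightarrow> G x 2 t" "(\<lambda>n. G (X n) 3 t) \<longlonglongrightarrow> G x 3 t"
        using tendsto_force[of \<epsilon> V "\<lambda>n. X n 1" "x 1" "\<lambda>n. X n 0 t" "x 0 t" t, OF \<epsilon> V(1) K(2)[OF X] K(2)[OF x] lim lim]
          tendsto_force[of \<epsilon> V "\<lambda>n. X n 0" "x 0" "\<lambda>n. X n 1 t" "x 1 t" t, OF \<epsilon> V(1) K(1)[OF X] K(1)[OF x] lim lim]
        by (simp_all add: G_def)
      ultimately show ?thesis using four[OF j] by blast
    qed
  qed
  obtain x where x: "x \<in> ?K" and dx: "\<And>j t. j < 4 \<Longrightarrow> (x j has_real_derivative G x j t) (at t)"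
    using existence by blast
  show ?thesis
    using lipschitz_curvesD(1)[OF x, of 0] lipschitz_curvesD(1)[OF x, of 1]
      lipschitz_curvesD(1)[OF x, of 2] lipschitz_curvesD(1)[OF x, of 3] dx[of 0] dx[of 1] dx[of 2] dx[of 3]
    by (intro exI[of _ "x 0"] exI[of _ "x 1"] exI[of _ "x 2"] exI[of _ "x 3"]) (simp add: G_def \<xi>_def)
qed

section \<open>A priori bounds\<close>

lemma DERIV_nonneg_imp_mono:
  fixes f :: "real \<Rightarrow> real"
  assumes "a \<le> b" "\<And>x. a \<le> x \<Longrightarrow> x \<le> b \<Longrightarrow> (f has_real_derivative f' x) (at x)" "\<And>x. a \<le> x \<Longrightarrow> x \<le> b \<Longrightarrow> 0 \<le> f' x"
  shows "f a \<le> f b"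
  using assms by (intro DERIV_nonneg_imp_nondecreasing[of a b f]) auto

text \<open>
  Writing the trajectories as \<open>A = a\<close> and \<open>B = - b\<close> makes the two equations of motion interchangeable.
\<close>

locale truncated_system =
  fixes A B p q :: "real \<Rightarrow> real" and \<epsilon> Q :: real
  assumes \<epsilon>: "0 < \<epsilon>" and Q: "0 < Q"
    and dA: "\<And>t. (A has_real_derivative speed (clip (- Q) Q (p t))) (at t)"
    and dB: "\<And>t. (B has_real_derivative speed (clip (- Q) Q (q t))) (at t)"
    and dp: "\<And>t. (p has_real_derivative force \<epsilon> B (A t) t) (at t)"
    and dq: "\<And>t. (q has_real_derivative force \<epsilon> A (B t) t) (at t)"
begin

lemma swap: "truncated_system B A q p \<epsilon> Q"
  using truncated_system_axioms by (simp add: truncated_system_def)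

text \<open>Time reversal negates momenta and exchanges advanced and retarded delays, in which the
  force is symmetric. Bounds for positive times thereby extend to negative ones.\<close>

lemma reflect: "truncated_system (\<lambda>t. A (- t)) (\<lambda>t. B (- t)) (\<lambda>t. - p (- t)) (\<lambda>t. - q (- t)) \<epsilon> Q"
proof
  have clip_minus: "clip (- Q) Q (- x) = - clip (- Q) Q x" for x
    using Q by (auto simp: clip_def)
  have force_reflect: "force \<epsilon> (\<lambda>t. f (- t)) x t = force \<epsilon> f x (- t)" for f x t
    by (simp add: force_def delay_def add.commute)
  show "((\<lambda>t. A (- t)) has_real_derivative speed (clip (- Q) Q (- p (- t)))) (at t)" for t
    using dA[of "- t"] by (simp add: DERIV_mirror clip_minus)
  show "((\<lambda>t. B (- t)) has_real_derivative speed (clip (- Q) Q (- q (- t)))) (at t)" for t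
    using dB[of "- t"] by (simp add: DERIV_mirror clip_minus)
  show "((\<lambda>t. - p (- t)) has_real_derivative force \<epsilon> (\<lambda>t. B (- t)) (A (- t)) t) (at t)" for t
    using DERIV_minus[OF dp[of "- t", unfolded DERIV_mirror]] by (simp add: force_reflect)
  show "((\<lambda>t. - q (- t)) has_real_derivative force \<epsilon> (\<lambda>t. A (- t)) (B (- t)) t) (at t)" for t
    using DERIV_minus[OF dq[of "- t", unfolded DERIV_mirror]] by (simp add: force_reflect)
qed (use \<epsilon> Q in auto)

lemma speed_Q: "speed Q < 1" "0 < speed Q"
  using speed_bounded[of Q] Q by (auto simp: speed_def)

abbreviation "vA t \<equiv> speed (clip (- Q) Q (p t))"
abbreviation "vB t \<equiv> speed (clip (- Q) Q (q t))"

lemma vA_abs_le: "\<bar>vA t\<bar> \<le> speed Q"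
proof -
  have "speed (- Q) \<le> vA t" "vA t \<le> speed Q"
    using Q by (simp_all only: strict_mono_less_eq[OF strict_mono_speed]) (auto simp: clip_def)
  then show ?thesis by simp
qed

lemma A_lipschitz: "\<bar>A t - A s\<bar> \<le> speed Q * \<bar>t - s\<bar>"
  by (rule field_differentiable_bound[of UNIV A vA, unfolded real_norm_def]) (use dA vA_abs_le in auto)

lemma p_mono: "s \<le> t \<Longrightarrow> p s \<le> p t"
  by (rule DERIV_nonneg_imp_mono[OF _ dp]) (auto intro: force_nonneg)

lemma vA_mono: "s \<le> t \<Longrightarrow> vA s \<le> vA t"
  unfolding strict_mono_less_eq[OF strict_mono_speed] by (intro clip_mono p_mono)

text \<open>Because \<open>y < Q\<close>, the clip cannot be active from above, so the truncated
  speed controls the momentum itself.\<close>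

lemma momentum_le_of_speed_le:
  assumes "vA t \<le> speed y" "y < Q"
  shows "p t \<le> y"
  using assms unfolding strict_mono_less_eq[OF strict_mono_speed] by (auto simp: clip_def)

lemma delay_A_eq: "\<bar>\<sigma>\<bar> = 1 \<Longrightarrow> delay \<sigma> B (A t) t = A t + B (t + \<sigma> * delay \<sigma> B (A t) t)"
  by (rule delay_eq[of "speed Q"]) (use speed_Q truncated_system.A_lipschitz[OF swap] in auto)

end

text \<open>
  The value of \<open>m\<close> comes from the monotonicity of \<open>p - c\<^sup>2 / (2 * d)\<close> during an
  approach, from the time on at which the retarded time of \<open>A\<close> is nonnegative.
\<close>

locale approach = truncated_system +
  fixes P0 d0 c m :: real
  assumes d0: "A 0 + B 0 = d0" "0 < d0"
    and P0: "\<bar>p 0\<bar> \<le> P0" "\<bar>q 0\<bar> \<le> P0" "P0 < Q"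
    and c_def: "c = 1 - speed P0"
    and m_def: "m = 1 / (4 / (c * d0) + 4 * P0 / c\<^sup>2)"
    and \<epsilon>_less: "\<epsilon> < m"
begin

lemma swap_approach: "approach B A q p \<epsilon> Q P0 d0 c m"
  using swap d0 P0 c_def m_def \<epsilon>_less by (simp add: approach_def approach_axioms_def add.commute)

lemma reflect_approach: "approach (\<lambda>t. A (- t)) (\<lambda>t. B (- t)) (\<lambda>t. - p (- t)) (\<lambda>t. - q (- t)) \<epsilon> Q P0 d0 c m"
  using reflect d0 P0 c_def m_def \<epsilon>_less by (simp add: approach_def approach_axioms_def)

lemma P0_nonneg: "0 \<le> P0" using P0(1) by simp

lemma c: "0 < c" "c \<le> 1"
  using speed_bounded[of P0] P0_nonneg by (auto simp: c_def speed_def)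

lemma m_pos: "0 < m"
  using c d0 P0_nonneg by (auto simp: m_def intro!: add_pos_nonneg divide_pos_pos)

abbreviation "d t \<equiv> A t + B t"

lemma DERIV_d: "(d has_real_derivative vA t + vB t) (at t)"
  by (intro DERIV_add dA dB)

lemma vB_mono: "s \<le> t \<Longrightarrow> vB s \<le> vB t"
  by (rule truncated_system.vA_mono[OF swap])

lemma vA_0: "- speed P0 \<le> vA 0" "vA 0 \<le> speed P0"
proof -
  have "speed (- P0) \<le> vA 0" "vA 0 \<le> speed P0"
    using P0 by (simp_all only: strict_mono_less_eq[OF strict_mono_speed]) (auto simp: clip_def)
  then show "- speed P0 \<le> vA 0" "vA 0 \<le> speed P0" by simp_all
qed

lemma vA_ge: "0 \<le> t \<Longrightarrow> - speed P0 \<le> vA t"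
  using vA_mono[of 0 t] vA_0(1) by linarith

lemma vB_ge: "0 \<le> t \<Longrightarrow> - speed P0 \<le> vB t"
  by (rule approach.vA_ge[OF swap_approach])

lemma p_0: "0 \<le> t \<Longrightarrow> - P0 \<le> p t"
  using p_mono[of 0 t] P0 by linarith

lemma A_diff_ge:
  assumes "0 \<le> s" "s \<le> t"
  shows "A t - A s \<ge> - speed P0 * (t - s)"
proof -
  have "A s + speed P0 * s \<le> A t + speed P0 * t"
  proof (rule DERIV_nonneg_imp_mono[OF assms(2)])
    show "((\<lambda>t. A t + speed P0 * t) has_real_derivative vA x + speed P0) (at x)" for x
      by (auto intro!: derivative_eq_intros dA)
    show "0 \<le> vA x + speed P0" if "s \<le> x" for x
      using vA_ge[of x] assms(1) that by linarith
  qed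
  then show ?thesis by (simp add: algebra_simps)
qed

lemma B_diff_ge: "0 \<le> s \<Longrightarrow> s \<le> t \<Longrightarrow> B t - B s \<ge> - speed P0 * (t - s)"
  by (rule approach.A_diff_ge[OF swap_approach])

text \<open>By \<open>seen\<close>, the retarded time \<open>t - s\<close> is nonnegative. Since
  then \<open>B\<close> has decreased at rate at most \<open>speed P0\<close>, so the retarded delay
  satisfies \<open>c * s \<le> d t\<close>; the advanced force is only bounded below by 0.\<close>

lemma force_ge_distance:
  assumes t: "0 \<le> t" and seen: "A t + B 0 \<le> t" and \<epsilon>d: "\<epsilon> \<le> d t"
  shows "force \<epsilon> B (A t) t \<ge> c\<^sup>2 / (d t)\<^sup>2"
proof -
  define s where "s = delay (- 1) B (A t) t"
  have s: "s = A t + B (t - s)"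
    using delay_A_eq[of "- 1" t] by (simp add: s_def)
  \<comment> \<open>A contact before time 0 would require \<open>B\<close> to move at the speed of
    light between that contact and time 0.\<close>
  have "s \<le> t"
  proof (rule ccontr)
    assume "\<not> s \<le> t"
    then have "speed Q * \<bar>(t - s) - 0\<bar> < 1 * \<bar>(t - s) - 0\<bar>"
      using speed_Q by (intro mult_strict_right_mono) auto
    then have "\<bar>B (t - s) - B 0\<bar> < \<bar>t - s\<bar>"
      using truncated_system.A_lipschitz[OF swap, of "t - s" 0] by simp
    then show False
      using s seen \<open>\<not> s \<le> t\<close> by linarith
  qed
  have dpos: "0 < d t" using \<epsilon> \<epsilon>d by simp
  have "c * s \<le> d t"
  proof (cases "0 \<le> s")
    case True
    then have "B t - B (t - s) \<ge> - speed P0 * s"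
      using B_diff_ge[of "t - s" t] \<open>s \<le> t\<close> by simp
    then show ?thesis using s by (simp add: c_def algebra_simps)
  next
    case False
    then show ?thesis using c dpos by (meson less_le_trans linorder_not_le mult_pos_neg order_less_imp_le)
  qed
  moreover have "c * \<epsilon> \<le> 1 * d t"
    using c \<epsilon> \<epsilon>d by (intro mult_mono) auto
  ultimately have "c * max s \<epsilon> \<le> d t" by (auto simp: max_def)
  then have "(c * max s \<epsilon>)\<^sup>2 \<le> (d t)\<^sup>2"
    using c \<epsilon> by (intro power_mono) auto
  then have "c\<^sup>2 / (d t)\<^sup>2 \<le> coulomb \<epsilon> s"
    using dpos \<epsilon> by (simp add: coulomb_def field_simps)
  then show ?thesis
    using coulomb_nonneg[of \<epsilon> "delay 1 B (A t) t"] by (simp add: force_def s_def)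
qed

text \<open>At such a time \<open>A\<close> is still at distance at least \<open>t\<close> from the
  initial position of \<open>B\<close>, which has come closer by at most \<open>(1 - c) * t\<close>;
  this leaves \<open>c * t\<close>. For small \<open>t\<close> the initial distance is not yet used
  up.\<close>

lemma d_ge_unseen:
  assumes t: "0 \<le> t" and unseen: "t \<le> A t + B 0"
  shows "c * d0 / 4 \<le> d t"
proof -
  have v: "speed P0 = 1 - c" by (simp add: c_def)
  have A: "A t \<ge> A 0 - (1 - c) * t" and B: "B t \<ge> B 0 - (1 - c) * t"
    using A_diff_ge[of 0 t] B_diff_ge[of 0 t] t by (simp_all add: v algebra_simps)
  show ?thesis
  proof (cases "d0 / 4 \<le> t")
    case True
    then have "c * (d0 / 4) \<le> c * t"
      using c by (intro mult_left_mono) auto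
    then show ?thesis using B unseen by (simp add: algebra_simps)
  next
    case False
    have "(1 - c) * t \<le> 1 * t" "c * (d0 / 4) \<le> 1 * (d0 / 4)"
      using c t d0 by (intro mult_right_mono; simp)+
    with A B False d0 show ?thesis by linarith
  qed
qed

lemma d_ge_while_approaching:
  assumes t: "0 \<le> t" and vt: "vA t + vB t \<le> 0" and \<epsilon>t: "\<epsilon> \<le> d t"
  shows "m \<le> d t"
proof -
  have cd0: "0 < c * d0 / 4" using c d0 by simp
  have "1 / d t \<le> 4 / (c * d0) + 4 * P0 / c\<^sup>2"
  proof (cases "t \<le> A t + B 0")
    case True
    then have "1 / d t \<le> 1 / (c * d0 / 4)"
      using d_ge_unseen[OF t] cd0 by (intro divide_left_mono) auto
    then show ?thesis using P0_nonneg by (simp add: add_increasing2)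
  next
    case False
    have "continuous_on {0..t} (\<lambda>t. t - A t - B 0)"
      by (intro continuous_intros DERIV_continuous_on[OF has_field_derivative_at_within[OF dA]])
    \<comment> \<open>At \<open>t0\<close> the retarded contact of \<open>A\<close> is the event of
      \<open>B\<close> at time 0; later contacts are later, since \<open>t - A t\<close> increases
      at subluminal speed.\<close>
    then obtain t0 where t0: "0 \<le> t0" "t0 \<le> t" "t0 - A t0 - B 0 = 0"
      using IVT'[of "\<lambda>t. t - A t - B 0" 0 0 t] t d0 False by auto
    have seen: "A s + B 0 \<le> s" if "t0 \<le> s" for s
    proof -
      have "t0 - A t0 \<le> s - A s"
        by (rule DERIV_nonneg_imp_mono[OF that, of _ "\<lambda>t. 1 - vA t"])
          (auto intro!: derivative_eq_intros dA simp: less_imp_le[OF abs_less_iff[THEN iffD1, OF speed_bounded, THEN conjunct1]])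
      then show ?thesis using t0 by simp
    qed
    have dt0: "c * d0 / 4 \<le> d t0"
      using t0 by (intro d_ge_unseen) auto
    \<comment> \<open>Velocities are monotone, so the approach at time \<open>t\<close> has lasted
      since time 0.\<close>
    have ds: "d t \<le> d s" if "0 \<le> s" "s \<le> t" for s
    proof -
      have "- d s \<le> - d t"
      proof (rule DERIV_nonneg_imp_mono[OF that(2)])
        show "((\<lambda>s. - d s) has_real_derivative - (vA x + vB x)) (at x)" for x
          by (intro DERIV_minus DERIV_d)
        show "0 \<le> - (vA x + vB x)" if "x \<le> t" for x
          using vA_mono[OF that] vB_mono[OF that] vt by linarith
      qed
      then show ?thesis by simp
    qed
    \<comment> \<open>The force is at least \<open>c^2 / d^2\<close>, and \<open>d\<close> decreases
      at rate at most 2, so the derivative of this expression is nonnegative.\<close>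
    have "p t0 - c\<^sup>2 / 2 * (1 / d t0) \<le> p t - c\<^sup>2 / 2 * (1 / d t)"
    proof (rule DERIV_nonneg_imp_mono[OF t0(2)])
      fix x assume x: "t0 \<le> x" "x \<le> t"
      then have dx: "\<epsilon> \<le> d x" using ds[of x] \<epsilon>t t0 by simp
      then have dpos: "0 < d x" using \<epsilon> by simp
      show "((\<lambda>x. p x - c\<^sup>2 / 2 * (1 / d x)) has_real_derivative
          force \<epsilon> B (A x) x + c\<^sup>2 / 2 * ((vA x + vB x) / (d x)\<^sup>2)) (at x)"
      proof -
        have "((\<lambda>x. 1 / d x) has_real_derivative - ((vA x + vB x) / (d x)\<^sup>2)) (at x)"
          using DERIV_inverse_fun[OF DERIV_d] dpos by (simp add: divide_simps power2_eq_square)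
        from DERIV_diff[OF dp DERIV_cmult[OF this, of "c\<^sup>2 / 2"]] show ?thesis
          by (simp only: mult_minus_right diff_minus_eq_add)
      qed
      have "vA x + vB x \<ge> - 2"
        using speed_bounded[of "clip (- Q) Q (p x)"] speed_bounded[of "clip (- Q) Q (q x)"] by linarith
      then have "c\<^sup>2 / 2 * ((vA x + vB x) / (d x)\<^sup>2) \<ge> c\<^sup>2 / 2 * (- 2 / (d x)\<^sup>2)"
        by (intro mult_left_mono divide_right_mono) auto
      moreover have "force \<epsilon> B (A x) x \<ge> c\<^sup>2 / (d x)\<^sup>2"
        using x t0 dx by (intro force_ge_distance seen) auto
      ultimately show "0 \<le> force \<epsilon> B (A x) x + c\<^sup>2 / 2 * ((vA x + vB x) / (d x)\<^sup>2)"
        by simp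
    qed
    \<comment> \<open>During the approach \<open>vA t \<le> - vB t \<le> speed P0\<close>.\<close>
    moreover have "p t \<le> P0"
      using vt vB_ge[OF t] P0 by (intro momentum_le_of_speed_le) auto
    moreover have "- P0 \<le> p t0" using p_0 t0 by blast
    ultimately have "c\<^sup>2 / 2 * (1 / d t - 1 / d t0) \<le> 2 * P0"
      by (simp add: right_diff_distrib)
    then have "1 / d t - 1 / d t0 \<le> 4 * P0 / c\<^sup>2"
      using c by (simp add: field_simps)
    moreover have "1 / d t0 \<le> 1 / (c * d0 / 4)"
      using dt0 cd0 by (intro divide_left_mono) auto
    ultimately show ?thesis by simp
  qed
  moreover have "0 < d t" using \<epsilon> \<epsilon>t by simp
  ultimately show ?thesis
    using le_imp_inverse_le[of "1 / d t"] by (simp add: m_def inverse_eq_divide)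
qed

text \<open>A violation of the bound is moved back to a time that
  \<open>d_ge_while_approaching\<close> covers: during an approach and at distance at least
  \<open>\<epsilon>\<close>.\<close>

lemma d_ge:
  assumes t: "0 \<le> t"
  shows "m \<le> d t"
proof (rule ccontr)
  assume less: "\<not> m \<le> d t"
  have cont: "continuous_on S d" "continuous_on S (\<lambda>t. vA t + vB t)" for S
  proof -
    show "continuous_on S d"
      by (rule DERIV_continuous_on[OF has_field_derivative_at_within[OF DERIV_d]])
    have pq: "continuous_on S p" "continuous_on S q"
      by (rule DERIV_continuous_on[OF has_field_derivative_at_within[OF dp]],
          rule DERIV_continuous_on[OF has_field_derivative_at_within[OF dq]])
    show "continuous_on S (\<lambda>t. vA t + vB t)"
      unfolding speed_def clip_def by (intro continuous_intros pq) auto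
  qed
  have "1 / m \<ge> 1 / d0"
  proof -
    have "c * d0 \<le> 1 * d0" using c d0 by (intro mult_right_mono) auto
    then have "4 / (c * d0) \<ge> 1 / d0"
      using c d0 by (intro frac_le) auto
    moreover have "4 * P0 / c\<^sup>2 \<ge> 0" using P0_nonneg by simp
    ultimately show ?thesis by (simp add: m_def)
  qed
  then have md0: "m \<le> d0" using m_pos d0 by (simp add: field_simps)
  have "0 < t" using less md0 d0 t by (cases "t = 0") auto
  \<comment> \<open>If the particles are already separating at \<open>t\<close>, there was a turning
    point before, since \<open>d t < d 0\<close>; the distance there is no larger.\<close>
  have "\<exists>s\<ge>0. d s < m \<and> vA s + vB s \<le> 0"
  proof (cases "vA t + vB t \<le> 0")
    case False
    obtain z where z: "0 < z" "z < t" "d t - d 0 = (t - 0) * (vA z + vB z)"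
      using MVT2[OF \<open>0 < t\<close>, of d "\<lambda>z. vA z + vB z"] DERIV_d by blast
    then have "vA z + vB z < 0"
      using less md0 d0 \<open>0 < t\<close> by (smt (verit) mult_nonneg_nonneg)
    then obtain s where s: "z \<le> s" "s \<le> t" "vA s + vB s = 0"
      using IVT'[of "\<lambda>t. vA t + vB t" z 0 t] cont(2) False z by force
    have "d s \<le> d t"
    proof (rule DERIV_nonneg_imp_mono[OF s(2) DERIV_d])
      show "0 \<le> vA x + vB x" if "s \<le> x" for x
        using vA_mono[OF that] vB_mono[OF that] s by linarith
    qed
    then show ?thesis using s z less by (intro exI[of _ s]) auto
  qed (use less t in auto)
  then obtain s where s: "0 \<le> s" "d s < m" "vA s + vB s \<le> 0" by blast
  \<comment> \<open>Going further back, the distance passes every value up to \<open>d0\<close>, in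
    particular one in \<open>[\<epsilon>, m[\<close>.\<close>
  obtain u where u: "0 \<le> u" "u \<le> s" "d u = max \<epsilon> (d s)"
    using IVT2'[of d s "max \<epsilon> (d s)" 0] s cont(1) md0 \<epsilon>_less d0 by force
  have "vA u + vB u \<le> 0"
    using vA_mono[OF u(2)] vB_mono[OF u(2)] s by linarith
  then have "m \<le> d u" using u by (intro d_ge_while_approaching) auto
  then show False using u s \<epsilon>_less by auto
qed

text \<open>During a delay \<open>s\<close> the particle \<open>B\<close> moves by at most
  \<open>\<bar>s\<bar>\<close>, so \<open>d t - \<bar>s\<bar> \<le> s\<close>. This also excludes
  negative delays.\<close>

lemma delay_ge:
  assumes \<sigma>: "\<bar>\<sigma>\<bar> = 1" and dpos: "0 < d t"
  shows "d t / 2 \<le> delay \<sigma> B (A t) t"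
proof -
  define s where "s = delay \<sigma> B (A t) t"
  have s: "s = A t + B (t + \<sigma> * s)"
    using delay_A_eq[OF \<sigma>] by (simp add: s_def)
  have "\<bar>B (t + \<sigma> * s) - B t\<bar> \<le> speed Q * \<bar>s\<bar>"
    using truncated_system.A_lipschitz[OF swap, of "t + \<sigma> * s" t] \<sigma> by (simp add: abs_mult)
  also have "\<dots> \<le> 1 * \<bar>s\<bar>"
    using speed_Q by (intro mult_right_mono) auto
  finally have "d t - \<bar>s\<bar> \<le> s" using s by linarith
  then have "d t / 2 \<le> s" using dpos by (cases "0 \<le> s") auto
  then show ?thesis unfolding s_def .
qed

lemma force_le_distance:
  assumes dpos: "0 < d t"
  shows "force \<epsilon> B (A t) t \<le> 8 / (d t)\<^sup>2"
proof -
  have "coulomb \<epsilon> (delay \<sigma> B (A t) t) \<le> 1 / (d t / 2)\<^sup>2" if "\<bar>\<sigma>\<bar> = 1" for \<sigma>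
    unfolding coulomb_def using delay_ge[OF that dpos] dpos
    by (intro divide_left_mono power_mono) (auto intro!: mult_pos_pos)
  from this[of 1] this[of "- 1"] show ?thesis
    by (simp add: force_def power_divide)
qed

end

text \<open>
  By the time \<open>\<tau>\<close> the particles have been pushed apart so strongly that from then on they separate
  at a rate of at least \<open>\<eta>\<close>: otherwise their speeds would have stayed below
  \<open>(1 + speed P0) / 2 = speed P1\<close>, and the retarded force would have driven the momentum above \<open>P1\<close>.
\<close>

locale separation = approach +
  fixes P1 \<tau> \<eta> :: real
  assumes P1_def: "P1 = momentum ((1 + speed P0) / 2)" and P1_less: "P1 < Q"
    and \<tau>_def: "\<tau> = 2 * d0 / c + 4 * d0\<^sup>2 * (P1 + P0 + 1) / c\<^sup>2"
    and \<eta>_def: "\<eta> = min (d0 / \<tau>) (c / 2)"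
begin

lemma swap_separation: "separation B A q p \<epsilon> Q P0 d0 c m P1 \<tau> \<eta>"
  using swap_approach P1_def P1_less \<tau>_def \<eta>_def by (simp add: separation_def separation_axioms_def)

lemma reflect_separation:
  "separation (\<lambda>t. A (- t)) (\<lambda>t. B (- t)) (\<lambda>t. - p (- t)) (\<lambda>t. - q (- t)) \<epsilon> Q P0 d0 c m P1 \<tau> \<eta>"
  using reflect_approach P1_def P1_less \<tau>_def \<eta>_def by (simp add: separation_def separation_axioms_def)

lemma P1: "0 \<le> P1" "speed P1 = 1 - c / 2"
proof -
  have v: "0 \<le> (1 + speed P0) / 2" "(1 + speed P0) / 2 < 1"
    using c by (auto simp: c_def)
  then show "0 \<le> P1"
    unfolding P1_def momentum_def by (intro divide_nonneg_nonneg) (auto simp: abs_square_le_1)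
  show "speed P1 = 1 - c / 2"
    unfolding P1_def using v by (subst speed_momentum) (auto simp: c_def field_simps)
qed

lemma \<tau>_pos: "2 * d0 / c \<le> \<tau>" "0 < \<tau>"
proof -
  have "0 \<le> 4 * d0\<^sup>2 * (P1 + P0 + 1) / c\<^sup>2"
    using P1(1) P0_nonneg by simp
  moreover have "0 < 2 * d0 / c" using d0 c by simp
  ultimately show "2 * d0 / c \<le> \<tau>" "0 < \<tau>" unfolding \<tau>_def by linarith+
qed

lemma \<eta>: "0 < \<eta>" "\<eta> * \<tau> \<le> d0" "\<eta> \<le> c / 2"
  using \<tau>_pos d0 c by (auto simp: \<eta>_def min_def field_simps)

lemma separation_rate: "\<eta> \<le> vA \<tau> + vB \<tau>"
proof (rule ccontr)
  assume "\<not> \<eta> \<le> vA \<tau> + vB \<tau>"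
  then have slow: "vA t + vB t \<le> \<eta>" if "t \<le> \<tau>" for t
    using vA_mono[OF that] vB_mono[OF that] by linarith
  \<comment> \<open>From \<open>\<eta> \<le> c / 2\<close> and
    \<open>vB t \<ge> - speed P0 = c - 1\<close>.\<close>
  have vA_le: "vA t \<le> speed P1" if "0 \<le> t" "t \<le> \<tau>" for t
    using slow[OF that(2)] vB_ge[OF that(1)] \<eta>(3) unfolding P1(2) by (simp add: c_def field_simps)
  \<comment> \<open>From \<open>t0\<close> on, the slack \<open>c / 2\<close> in the speed of
    \<open>A\<close> has made up for the initial distance, so that \<open>force_ge_distance\<close>
    applies.\<close>
  define t0 where "t0 = 2 * d0 / c"
  have t0: "0 \<le> t0" "t0 \<le> \<tau>" using \<tau>_pos d0 c by (auto simp: t0_def)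
  have "p t0 - c\<^sup>2 / (4 * d0\<^sup>2) * t0 \<le> p \<tau> - c\<^sup>2 / (4 * d0\<^sup>2) * \<tau>"
  proof (rule DERIV_nonneg_imp_mono[OF t0(2)])
    fix t assume t: "t0 \<le> t" "t \<le> \<tau>"
    then have t_pos: "0 \<le> t" using t0 by simp
    show "((\<lambda>t. p t - c\<^sup>2 / (4 * d0\<^sup>2) * t) has_real_derivative force \<epsilon> B (A t) t - c\<^sup>2 / (4 * d0\<^sup>2)) (at t)"
      by (rule DERIV_diff[OF dp DERIV_cmult_Id])
    have "A t - speed P1 * t \<le> A 0 - speed P1 * 0"
    proof -
      have "speed P1 * 0 - A 0 \<le> speed P1 * t - A t"
      proof (rule DERIV_nonneg_imp_mono[OF t_pos])
        show "((\<lambda>t. speed P1 * t - A t) has_real_derivative speed P1 - vA x) (at x)" for x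
          by (auto intro!: derivative_eq_intros dA)
        show "0 \<le> speed P1 - vA x" if "0 \<le> x" "x \<le> t" for x
          using vA_le[of x] that t by simp
      qed
      then show ?thesis by simp
    qed
    then have "A t + B 0 \<le> d0 + (1 - c / 2) * t"
      using d0 by (simp add: P1(2))
    also have "\<dots> \<le> t"
      using t c by (simp add: t0_def field_simps)
    finally have seen: "A t + B 0 \<le> t" .
    \<comment> \<open>With growth rate at most \<open>\<eta>\<close>, the distance stays below
      \<open>d0 + \<eta> * \<tau> \<le> 2 * d0\<close> until \<open>\<tau>\<close>.\<close>
    have "\<eta> * 0 - d 0 \<le> \<eta> * t - d t"
    proof (rule DERIV_nonneg_imp_mono[OF t_pos])
      show "((\<lambda>t. \<eta> * t - d t) has_real_derivative \<eta> - (vA x + vB x)) (at x)" for x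
        by (auto intro!: derivative_eq_intros dA dB)
      show "0 \<le> \<eta> - (vA x + vB x)" if "x \<le> t" for x
        using slow[of x] that t by simp
    qed
    moreover have "\<eta> * t \<le> \<eta> * \<tau>" using t \<eta>(1) by simp
    ultimately have dt: "d t \<le> 2 * d0" using d0 \<eta>(2) by simp
    have dt': "\<epsilon> \<le> d t" using d_ge[OF t_pos] \<epsilon>_less by simp
    then have "0 < d t" using \<epsilon> by simp
    then have "(d t)\<^sup>2 \<le> (2 * d0)\<^sup>2" using dt by (intro power_mono) auto
    then have "c\<^sup>2 / (2 * d0)\<^sup>2 \<le> c\<^sup>2 / (d t)\<^sup>2"
      using d0 \<open>0 < d t\<close> by (intro divide_left_mono) auto
    then show "0 \<le> force \<epsilon> B (A t) t - c\<^sup>2 / (4 * d0\<^sup>2)"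
      using force_ge_distance[OF t_pos seen dt'] by (simp add: power_mult_distrib)
  qed
  \<comment> \<open>The second summand of \<open>\<tau>\<close> is chosen so that the momentum
    gained exceeds by 1 the room between \<open>- P0\<close> and \<open>P1\<close>.\<close>
  moreover have "c\<^sup>2 / (4 * d0\<^sup>2) * (\<tau> - t0) = P1 + P0 + 1"
    using c d0 by (simp add: \<tau>_def t0_def)
  ultimately have "P1 + P0 + 1 \<le> p \<tau> - p t0" by (simp add: right_diff_distrib)
  moreover have "p \<tau> \<le> P1"
    using vA_le[of \<tau>] \<tau>_pos P1_less by (intro momentum_le_of_speed_le) auto
  ultimately show False using p_0[OF t0(1)] by simp
qed

text \<open>Until \<open>\<tau>\<close> the force is at most \<open>8 / m^2\<close>. Afterwards the
  distance is at least \<open>m + \<eta> * (t - \<tau>)\<close>, and the corresponding bound on the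
  force has total integral \<open>8 / (\<eta> * m)\<close>.\<close>

lemma p_le:
  assumes t: "0 \<le> t"
  shows "p t \<le> P0 + 8 * \<tau> / m\<^sup>2 + 8 / (\<eta> * m)"
proof -
  have dpos: "0 < d t" if "0 \<le> t" for t
    using d_ge[OF that] m_pos by simp
  have early: "p t \<le> P0 + 8 * \<tau> / m\<^sup>2" if t: "0 \<le> t" "t \<le> \<tau>" for t
  proof -
    have "8 / m\<^sup>2 * 0 - p 0 \<le> 8 / m\<^sup>2 * t - p t"
    proof (rule DERIV_nonneg_imp_mono[OF t(1)])
      show "((\<lambda>t. 8 / m\<^sup>2 * t - p t) has_real_derivative 8 / m\<^sup>2 - force \<epsilon> B (A x) x) (at x)" for x
        by (rule DERIV_diff[OF DERIV_cmult_Id dp])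
      fix x :: real assume x: "0 \<le> x"
      have "8 / (d x)\<^sup>2 \<le> 8 / m\<^sup>2"
        using d_ge[OF x] m_pos by (intro divide_left_mono power_mono) (auto intro!: mult_pos_pos)
      then show "0 \<le> 8 / m\<^sup>2 - force \<epsilon> B (A x) x"
        using force_le_distance[OF dpos[OF x]] by simp
    qed
    moreover have "8 / m\<^sup>2 * t \<le> 8 / m\<^sup>2 * \<tau>" using t by (intro mult_left_mono) auto
    ultimately show ?thesis using P0 by simp
  qed
  have "0 < 8 / (\<eta> * m)" using \<eta> m_pos by simp
  show ?thesis
  proof (cases "t \<le> \<tau>")
    case True
    then show ?thesis using early[OF t] \<open>0 < 8 / (\<eta> * m)\<close> by linarith
  next
    case False
    have far: "m + \<eta> * (x - \<tau>) \<le> d x" if "\<tau> \<le> x" for x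
    proof -
      have "d \<tau> - \<eta> * \<tau> \<le> d x - \<eta> * x"
      proof (rule DERIV_nonneg_imp_mono[OF that])
        show "((\<lambda>t. d t - \<eta> * t) has_real_derivative (vA x + vB x) - \<eta>) (at x)" for x
          by (auto intro!: derivative_eq_intros dA dB)
        show "0 \<le> (vA x + vB x) - \<eta>" if "\<tau> \<le> x" for x
          using separation_rate vA_mono[OF that] vB_mono[OF that] by linarith
      qed
      then show ?thesis using d_ge[of \<tau>] \<tau>_pos by (simp add: right_diff_distrib)
    qed
    have "- p \<tau> - 8 / \<eta> * (1 / (m + \<eta> * (\<tau> - \<tau>))) \<le> - p t - 8 / \<eta> * (1 / (m + \<eta> * (t - \<tau>)))"
    proof (rule DERIV_nonneg_imp_mono[where f = "\<lambda>t. - p t - 8 / \<eta> * (1 / (m + \<eta> * (t - \<tau>)))"])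
      show "\<tau> \<le> t" using False by simp
      fix x assume x: "\<tau> \<le> x"
      define D where "D = m + \<eta> * (x - \<tau>)"
      have D: "0 < D" using m_pos \<eta>(1) x by (simp add: D_def add_pos_nonneg)
      show "((\<lambda>t. - p t - 8 / \<eta> * (1 / (m + \<eta> * (t - \<tau>)))) has_real_derivative
          8 / D\<^sup>2 - force \<epsilon> B (A x) x) (at x)"
      proof -
        have "((\<lambda>t. m + \<eta> * (t - \<tau>)) has_real_derivative \<eta>) (at x)"
          by (auto intro!: derivative_eq_intros)
        from DERIV_inverse_fun[OF this] D
        have "((\<lambda>t. 1 / (m + \<eta> * (t - \<tau>))) has_real_derivative - (\<eta> / D\<^sup>2)) (at x)"
          by (simp add: D_def divide_simps power2_eq_square)
        from DERIV_diff[OF DERIV_minus[OF dp] DERIV_cmult[OF this, of "8 / \<eta>"]] show ?thesis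
          using \<eta>(1) by simp
      qed
      have "8 / (d x)\<^sup>2 \<le> 8 / D\<^sup>2"
        using far[OF x] D unfolding D_def[symmetric]
        by (intro divide_left_mono power_mono) (auto intro!: mult_pos_pos)
      then show "0 \<le> 8 / D\<^sup>2 - force \<epsilon> B (A x) x"
        using force_le_distance[OF dpos, of x] x \<tau>_pos by simp
    qed
    moreover have "0 \<le> 8 / \<eta> * (1 / (m + \<eta> * (t - \<tau>)))"
      using \<eta>(1) m_pos False by (intro mult_nonneg_nonneg divide_nonneg_nonneg) auto
    moreover have "8 / \<eta> * (1 / (m + \<eta> * (\<tau> - \<tau>))) = 8 / (\<eta> * m)" by simp
    ultimately show ?thesis
      using early[of \<tau>] \<tau>_pos by linarith
  qed
qed

lemma bounds:
  "m \<le> d t" "\<bar>p t\<bar> \<le> P0 + 8 * \<tau> / m\<^sup>2 + 8 / (\<eta> * m)" "\<bar>q t\<bar> \<le> P0 + 8 * \<tau> / m\<^sup>2 + 8 / (\<eta> * m)"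
proof -
  \<comment> \<open>Stated for an arbitrary system, so that it applies to the time-reversed one as
    well.\<close>
  have forward: "m \<le> A t + B t \<and> \<bar>p t\<bar> \<le> P0 + 8 * \<tau> / m\<^sup>2 + 8 / (\<eta> * m) \<and>
      \<bar>q t\<bar> \<le> P0 + 8 * \<tau> / m\<^sup>2 + 8 / (\<eta> * m)"
    if "separation A B p q \<epsilon> Q P0 d0 c m P1 \<tau> \<eta>" and t: "0 \<le> t" for A B p q t
  proof -
    interpret s: separation A B p q \<epsilon> Q P0 d0 c m P1 \<tau> \<eta> by fact
    interpret s': separation B A q p \<epsilon> Q P0 d0 c m P1 \<tau> \<eta> by (rule s.swap_separation)
    have "0 \<le> 8 * \<tau> / m\<^sup>2 + 8 / (\<eta> * m)"
      using s.\<tau>_pos s.\<eta> s.m_pos by simp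
    then show ?thesis
      using s.d_ge[OF t] s.p_le[OF t] s'.p_le[OF t] s.p_0[OF t] s'.p_0[OF t] by (simp add: abs_le_iff)
  qed
  show "m \<le> d t" "\<bar>p t\<bar> \<le> P0 + 8 * \<tau> / m\<^sup>2 + 8 / (\<eta> * m)" "\<bar>q t\<bar> \<le> P0 + 8 * \<tau> / m\<^sup>2 + 8 / (\<eta> * m)"
    using forward[OF separation_axioms, of t] forward[OF reflect_separation, of "- t"]
    by (cases "0 \<le> t"; simp)+
qed

end

section \<open>Smoothness\<close>

text \<open>Counting derivatives from the inside suits inductions that use the product and chain
  rules.\<close>

primrec times_differentiable :: "nat \<Rightarrow> (real \<Rightarrow> real) \<Rightarrow> bool" where
  "times_differentiable 0 f \<longleftrightarrow> True"
| "times_differentiable (Suc n) f \<longleftrightarrow> (\<forall>t. f differentiable (at t)) \<and> times_differentiable n (deriv f)"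

lemma smoothI:
  assumes "\<And>n. times_differentiable n f"
  shows "smooth f"
proof -
  have "times_differentiable (Suc n) f \<Longrightarrow> (deriv ^^ n) f differentiable (at t)" for n f t
    by (induction n arbitrary: f) (auto simp: funpow_swap1)
  then show ?thesis using assms unfolding smooth_def by blast
qed

lemma times_differentiable_SucI:
  assumes "\<And>t. (f has_real_derivative f' t) (at t)" "times_differentiable n f'"
  shows "times_differentiable (Suc n) f"
proof -
  have "deriv f = f'" using assms(1) by (intro ext DERIV_imp_deriv)
  then show ?thesis using assms by (auto simp: real_differentiable_def)
qed

lemma times_differentiable_SucD:
  assumes "times_differentiable (Suc n) f"
  shows "(f has_real_derivative deriv f t) (at t)" "times_differentiable n (deriv f)"
  using assms by (auto simp: DERIV_deriv_iff_real_differentiable)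

lemma times_differentiable_mono: "times_differentiable n f \<Longrightarrow> k \<le> n \<Longrightarrow> times_differentiable k f"
proof (induction n arbitrary: k f)
  case (Suc n)
  then show ?case by (cases k) auto
qed simp

lemma times_differentiable_const: "times_differentiable n (\<lambda>_. c)"
  by (induction n arbitrary: c) auto

lemma times_differentiable_id: "times_differentiable n (\<lambda>t. t)"
  by (cases n) (auto simp: times_differentiable_const)

lemma times_differentiable_add:
  "times_differentiable n f \<Longrightarrow> times_differentiable n g \<Longrightarrow> times_differentiable n (\<lambda>t. f t + g t)"
proof (induction n arbitrary: f g)
  case (Suc n)
  note f = times_differentiable_SucD[OF Suc.prems(1)] and g = times_differentiable_SucD[OF Suc.prems(2)]
  show ?case
    by (rule times_differentiable_SucI[OF DERIV_add[OF f(1) g(1)]]) (rule Suc.IH[OF f(2) g(2)])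
qed simp

lemma times_differentiable_mult:
  "times_differentiable n f \<Longrightarrow> times_differentiable n g \<Longrightarrow> times_differentiable n (\<lambda>t. f t * g t)"
proof (induction n arbitrary: f g)
  case (Suc n)
  note f = times_differentiable_SucD[OF Suc.prems(1)] and g = times_differentiable_SucD[OF Suc.prems(2)]
  have "times_differentiable n f" "times_differentiable n g"
    using Suc.prems times_differentiable_mono by (metis le_SucI order_refl)+
  then show ?case
    by (intro times_differentiable_SucI[OF DERIV_mult[OF f(1) g(1)]] times_differentiable_add Suc.IH f g)
qed simp

lemma times_differentiable_minus: "times_differentiable n f \<Longrightarrow> times_differentiable n (\<lambda>t. - f t)"
  using times_differentiable_mult[OF times_differentiable_const[of n "- 1"]] by simp

lemma times_differentiable_diff:
  "times_differentiable n f \<Longrightarrow> times_differentiable n g \<Longrightarrow> times_differentiable n (\<lambda>t. f t - g t)"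
  using times_differentiable_add[OF _ times_differentiable_minus] by simp

lemma times_differentiable_inverse:
  "times_differentiable n f \<Longrightarrow> (\<And>t. f t \<noteq> 0) \<Longrightarrow> times_differentiable n (\<lambda>t. inverse (f t))"
proof (induction n arbitrary: f)
  case (Suc n)
  note f = times_differentiable_SucD[OF Suc.prems(1)]
  have "times_differentiable n f"
    using Suc.prems times_differentiable_mono by (metis le_SucI order_refl)
  then have "times_differentiable n (\<lambda>t. inverse (f t))"
    using Suc by blast
  then show ?case
    using Suc.prems f
    by (intro times_differentiable_SucI[OF DERIV_inverse'] times_differentiable_minus times_differentiable_mult)
qed simp

lemma times_differentiable_compose:
  "times_differentiable n f \<Longrightarrow> times_differentiable n g \<Longrightarrow> times_differentiable n (\<lambda>t. f (g t))"
proof (induction n arbitrary: f)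
  case (Suc n)
  note f = times_differentiable_SucD[OF Suc.prems(1)] and g = times_differentiable_SucD[OF Suc.prems(2)]
  have "times_differentiable n g"
    using Suc.prems times_differentiable_mono by (metis le_SucI order_refl)
  then have "times_differentiable n (\<lambda>t. deriv f (g t) * deriv g t)"
    by (rule times_differentiable_mult[OF Suc.IH[OF f(2)] g(2)])
  then show ?case
    by (rule times_differentiable_SucI[OF DERIV_chain2[OF f(1) g(1)]])
qed simp

lemmas times_differentiable_intros = times_differentiable_const times_differentiable_id
  times_differentiable_add times_differentiable_mult times_differentiable_minus
  times_differentiable_diff times_differentiable_inverse

text \<open>The derivative of \<open>1 / sqrt (1 + p^2)\<close> is a polynomial in \<open>p\<close>
  and this function itself, so the induction closes.\<close>

lemma times_differentiable_speed: "times_differentiable n speed"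
proof -
  have "times_differentiable n (\<lambda>p::real. inverse (sqrt (1 + p\<^sup>2)))"
  proof (induction n)
    case (Suc n)
    let ?w = "\<lambda>p::real. inverse (sqrt (1 + p\<^sup>2))"
    have "(?w has_real_derivative - p * ?w p * ?w p * ?w p) (at p)" for p
      by (auto intro!: derivative_eq_intros simp: field_simps) (use one_plus_square_pos[of p] in linarith)
    then show ?case
      by (rule times_differentiable_SucI) (intro times_differentiable_intros Suc)
  qed simp
  then have "times_differentiable n (\<lambda>p. p * inverse (sqrt (1 + p\<^sup>2)))"
    by (rule times_differentiable_mult[OF times_differentiable_id])
  then show ?thesis
    unfolding speed_def[abs_def] by (simp add: divide_inverse)
qed

section \<open>Differentiating contact times\<close>

text \<open>Implicit differentiation in one variable, given continuity of the implicit
  function.\<close>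

lemma DERIV_implicit:
  fixes T h \<kappa> :: "real \<Rightarrow> real"
  assumes \<kappa>: "(\<kappa> has_real_derivative k) (at (T t))" "k \<noteq> 0"
    and eq: "\<And>u. \<kappa> (T u) = h u" and h: "(h has_real_derivative h') (at t)" and T: "isCont T t"
  shows "(T has_real_derivative h' / k) (at t)"
proof -
  \<comment> \<open>With Caratheodory's slope \<open>g\<close>, the difference quotient of
    \<open>T\<close> is that of \<open>h\<close> divided by \<open>g (T u)\<close>, whose limit
    \<open>k\<close> is nonzero.\<close>
  obtain g where g: "\<And>z. \<kappa> z - \<kappa> (T t) = g z * (z - T t)" "isCont g (T t)" "g (T t) = k"
    using \<kappa>(1) unfolding CARAT_DERIV by blast
  have "isCont (\<lambda>u. g (T u)) t"
    by (rule isCont_o2[OF T g(2)])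
  then have gT: "((\<lambda>u. g (T u)) \<longlongrightarrow> k) (at t)"
    using g(3) by (simp add: isCont_def)
  have "((\<lambda>u. ((h u - h t) / (u - t)) / g (T u)) \<longlongrightarrow> h' / k) (at t)"
    using h \<kappa>(2) gT unfolding has_field_derivative_iff by (intro tendsto_divide)
  moreover have "\<forall>\<^sub>F u in at t. ((h u - h t) / (u - t)) / g (T u) = (T u - T t) / (u - t)"
    using tendsto_imp_eventually_ne[OF gT \<kappa>(2)]
  proof eventually_elim
    case (elim u)
    then show ?case using g(1)[of "T u"] by (simp add: eq)
  qed
  ultimately show ?thesis
    unfolding has_field_derivative_iff by (rule Lim_transform_eventually)
qed

context truncated_system
begin

definition contact_time :: "real \<Rightarrow> real \<Rightarrow> real" where
  "contact_time \<sigma> t = t + \<sigma> * delay \<sigma> B (A t) t"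

text \<open>The contact time \<open>y\<close> solves
  \<open>y - \<sigma> * B y = t + \<sigma> * A t\<close>, which separates the variables and suits
  \<open>DERIV_implicit\<close>.\<close>

lemma DERIV_contact_time:
  assumes \<sigma>: "\<bar>\<sigma>\<bar> = 1"
  shows "(contact_time \<sigma> has_real_derivative (1 + \<sigma> * vA t) / (1 - \<sigma> * vB (contact_time \<sigma> t))) (at t)"
proof (rule DERIV_implicit)
  let ?\<kappa> = "\<lambda>y. y - \<sigma> * B y" and ?h = "\<lambda>t. t + \<sigma> * A t"
  show "(?\<kappa> has_real_derivative 1 - \<sigma> * vB (contact_time \<sigma> t)) (at (contact_time \<sigma> t))"
    by (auto intro!: derivative_eq_intros dB)
  have "\<bar>\<sigma> * vB (contact_time \<sigma> t)\<bar> < 1"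
    using speed_bounded by (simp add: abs_mult \<sigma>)
  then show "1 - \<sigma> * vB (contact_time \<sigma> t) \<noteq> 0" by auto
  show "?\<kappa> (contact_time \<sigma> u) = ?h u" for u
  proof -
    have "\<sigma> * delay \<sigma> B (A u) u = \<sigma> * (A u + B (contact_time \<sigma> u))"
      unfolding contact_time_def using delay_A_eq[OF \<sigma>, of u] by simp
    then show ?thesis by (simp add: contact_time_def algebra_simps)
  qed
  show "(?h has_real_derivative 1 + \<sigma> * vA t) (at t)"
    by (auto intro!: derivative_eq_intros dA)
  have "((\<lambda>u. delay \<sigma> B (A u) u - delay \<sigma> B (A t) t) \<longlongrightarrow> 0) (at t)"
  proof (rule Lim_null_comparison)
    show "\<forall>\<^sub>F u in at t. norm (delay \<sigma> B (A u) u - delay \<sigma> B (A t) t) \<le> 2 / (1 - speed Q) * \<bar>u - t\<bar>"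
      using delay_lipschitz[of "speed Q" \<sigma> B A, OF speed_Q(1) \<sigma> truncated_system.A_lipschitz[OF swap] A_lipschitz]
      by (intro always_eventually allI) simp
    have "((\<lambda>u. 2 / (1 - speed Q) * \<bar>u - t\<bar>) \<longlongrightarrow> 2 / (1 - speed Q) * \<bar>t - t\<bar>) (at t)"
      by (intro tendsto_intros)
    then show "((\<lambda>u. 2 / (1 - speed Q) * \<bar>u - t\<bar>) \<longlongrightarrow> 0) (at t)" by simp
  qed
  then have "isCont (\<lambda>u. delay \<sigma> B (A u) u) t"
    by (simp add: isCont_def LIM_zero_iff)
  then show "isCont (contact_time \<sigma>) t"
    unfolding contact_time_def[abs_def] by (intro continuous_intros)
qed

end

section \<open>Solutions that never meet the truncation\<close>

locale regular_system = truncated_system +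
  assumes below_cutoff: "\<And>t. \<bar>p t\<bar> \<le> Q" "\<And>t. \<bar>q t\<bar> \<le> Q"
    and delays: "\<And>\<sigma> t. \<bar>\<sigma>\<bar> = 1 \<Longrightarrow> \<epsilon> \<le> delay \<sigma> B (A t) t" "\<And>\<sigma> t. \<bar>\<sigma>\<bar> = 1 \<Longrightarrow> \<epsilon> \<le> delay \<sigma> A (B t) t"
begin

lemma swap_regular: "regular_system B A q p \<epsilon> Q"
  using swap below_cutoff delays by (simp add: regular_system_def regular_system_axioms_def)

lemma vA_eq: "vA t = speed (p t)"
  using below_cutoff(1)[of t] by (simp add: clip_def abs_le_iff min_def max_def)

lemma vB_eq: "vB t = speed (q t)"
  using below_cutoff(2)[of t] by (simp add: clip_def abs_le_iff min_def max_def)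

lemma DERIV_A: "(A has_real_derivative speed (p t)) (at t)"
  using dA[of t] by (simp add: vA_eq)

lemma DERIV_p: "(p has_real_derivative 1 / (delay (- 1) B (A t) t)\<^sup>2 + 1 / (delay 1 B (A t) t)\<^sup>2) (at t)"
  using dp[of t] delays(1)[of 1 t] delays(1)[of "- 1" t] by (simp add: force_def coulomb_def max_def add.commute)

text \<open>Velocities, contact times and delays are as often differentiable as the momenta, hence
  so is the force, and integrating it gains one derivative.\<close>

lemma bootstrap:
  assumes "times_differentiable n p" "times_differentiable n q"
  shows "times_differentiable (Suc n) A" "times_differentiable (Suc n) p"
proof -
  have vA: "times_differentiable n vA" and vB: "times_differentiable n vB"
    unfolding vA_eq vB_eq by (intro times_differentiable_compose[OF times_differentiable_speed] assms)+
  show "times_differentiable (Suc n) A"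
    by (rule times_differentiable_SucI[OF dA vA])
  have inv_sq: "times_differentiable n (\<lambda>t. 1 / (delay \<sigma> B (A t) t)\<^sup>2)" if \<sigma>: "\<bar>\<sigma>\<bar> = 1" for \<sigma>
  proof -
    have nz: "1 - \<sigma> * vB t \<noteq> 0" for t
    proof -
      have "\<bar>\<sigma> * vB t\<bar> < 1" using speed_bounded by (simp add: abs_mult \<sigma>)
      then show ?thesis by auto
    qed
    \<comment> \<open>An induction of its own, because the derivative of the contact time contains
      the contact time.\<close>
    have "k \<le> n \<Longrightarrow> times_differentiable k (contact_time \<sigma>)" for k
    proof (induction k)
      case (Suc k)
      have "times_differentiable k vA" "times_differentiable k vB" "times_differentiable k (contact_time \<sigma>)"
        using Suc vA vB times_differentiable_mono by auto
      then have "times_differentiable k (\<lambda>t. (1 + \<sigma> * vA t) * inverse (1 - \<sigma> * vB (contact_time \<sigma> t)))"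
        using nz times_differentiable_compose[of k vB "contact_time \<sigma>"]
        by (intro times_differentiable_intros)
      then show ?case
        by (intro times_differentiable_SucI[OF DERIV_contact_time[OF \<sigma>]]) (simp add: divide_inverse)
    qed simp
    then have T: "times_differentiable n (contact_time \<sigma>)" by simp
    \<comment> \<open>This recovers the delay from the contact time.\<close>
    have "\<sigma> * \<sigma> = 1" using \<sigma> by (auto simp: abs_if split: if_splits)
    then have s: "delay \<sigma> B (A t) t = \<sigma> * (contact_time \<sigma> t - t)" for t
      by (simp add: contact_time_def mult.assoc[symmetric])
    have "delay \<sigma> B (A t) t \<noteq> 0" for t
      using delays(1)[OF \<sigma>, of t] \<epsilon> by simp
    then have "times_differentiable n (\<lambda>t. inverse (delay \<sigma> B (A t) t) * inverse (delay \<sigma> B (A t) t))"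
      unfolding s by (intro times_differentiable_intros T)
    then show ?thesis by (simp add: divide_inverse power2_eq_square)
  qed
  show "times_differentiable (Suc n) p"
    by (rule times_differentiable_SucI[OF DERIV_p]) (intro times_differentiable_intros inv_sq; simp)
qed

lemma times_differentiable_momenta: "times_differentiable n p \<and> times_differentiable n q"
proof (induction n)
  case (Suc n)
  then show ?case
    using bootstrap(2) regular_system.bootstrap(2)[OF swap_regular] by blast
qed simp

lemma smooth_A: "smooth A"
proof (rule smoothI)
  show "times_differentiable n A" for n
    using bootstrap(1) times_differentiable_momenta times_differentiable_mono le_SucI order_refl by metis
qed

lemma smooth_B: "smooth (\<lambda>t. - B t)"
proof (rule smoothI)
  show "times_differentiable n (\<lambda>t. - B t)" for n
    using regular_system.bootstrap(1)[OF swap_regular] times_differentiable_momenta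
      times_differentiable_mono le_SucI order_refl times_differentiable_minus by metis
qed

lemma delay_pos: "\<bar>\<sigma>\<bar> = 1 \<Longrightarrow> 0 < delay \<sigma> B (A t) t"
  using delays(1)[of \<sigma> t] \<epsilon> by linarith

lemma B_ahead: "0 < delay 1 B (A t) t" "delay 1 B (A t) t = A t + B (t + delay 1 B (A t) t)"
  using delay_pos[of 1 t] delay_A_eq[of 1 t] by simp_all

lemma B_behind: "0 < delay (- 1) B (A t) t" "delay (- 1) B (A t) t = A t + B (t - delay (- 1) B (A t) t)"
  using delay_pos[of "- 1" t] delay_A_eq[of "- 1" t] by simp_all

lemma FST: "FST_solution A (\<lambda>t. - B t)"
proof -
  define b where "b t = - B t" for t
  note sw = swap_regular
  have dA': "deriv A t = speed (p t)" for t
    by (rule DERIV_imp_deriv[OF DERIV_A])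
  have Db: "(b has_real_derivative - speed (q t)) (at t)" for t
    unfolding b_def by (rule DERIV_minus[OF regular_system.DERIV_A[OF sw]])
  have db': "deriv b t = - speed (q t)" for t
    by (rule DERIV_imp_deriv[OF Db])
  have diff: "A differentiable (at t)" "b differentiable (at t)" for t
    using DERIV_A Db by (auto simp: real_differentiable_def)
  have slow: "\<bar>deriv A t\<bar> < 1" "\<bar>deriv b t\<bar> < 1" for t
    using speed_bounded by (simp_all add: dA' db')
  \<comment> \<open>Delays are positive, so they equal the absolute distances in the light-cone
    equations.\<close>
  have adv_ex: "t + delay 1 B (A t) t = t + \<bar>b (t + delay 1 B (A t) t) - A t\<bar>"
    and ret_ex: "t - delay (- 1) B (A t) t = t - \<bar>b (t - delay (- 1) B (A t) t) - A t\<bar>"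
    and adv_ex': "t + delay 1 A (B t) t = t + \<bar>A (t + delay 1 A (B t) t) - b t\<bar>"
    and ret_ex': "t - delay (- 1) A (B t) t = t - \<bar>A (t - delay (- 1) A (B t) t) - b t\<bar>" for t
    using B_ahead[of t] B_behind[of t] regular_system.B_ahead[OF sw, of t] regular_system.B_behind[OF sw, of t]
    unfolding b_def by linarith+
  have "t2_adv A b t = t + delay 1 B (A t) t" for t
    unfolding t2_adv_def abs_minus_commute[of "A t"]
    by (rule the_equality, rule adv_ex, rule advanced_time_unique[OF diff(2) slow(2) _ adv_ex])
  then have adv: "A t - b (t2_adv A b t) = delay 1 B (A t) t" for t
    using B_ahead(2)[of t] by (simp add: b_def)
  have "t2_ret A b t = t - delay (- 1) B (A t) t" for t
    unfolding t2_ret_def abs_minus_commute[of "A t"]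
    by (rule the_equality, rule ret_ex, rule retarded_time_unique[OF diff(2) slow(2) _ ret_ex])
  then have ret: "A t - b (t2_ret A b t) = delay (- 1) B (A t) t" for t
    using B_behind(2)[of t] by (simp add: b_def)
  have "t1_adv A b t = t + delay 1 A (B t) t" for t
    unfolding t1_adv_def
    by (rule the_equality, rule adv_ex', rule advanced_time_unique[OF diff(1) slow(1) _ adv_ex'])
  then have adv': "b t - A (t1_adv A b t) = - delay 1 A (B t) t" for t
    using regular_system.B_ahead(2)[OF sw, of t] by (simp add: b_def)
  have "t1_ret A b t = t - delay (- 1) A (B t) t" for t
    unfolding t1_ret_def
    by (rule the_equality, rule ret_ex', rule retarded_time_unique[OF diff(1) slow(1) _ ret_ex'])
  then have ret': "b t - A (t1_ret A b t) = - delay (- 1) A (B t) t" for t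
    using regular_system.B_behind(2)[OF sw, of t] by (simp add: b_def)
  \<comment> \<open>The functions to be differentiated are the momenta \<open>p\<close> and
    \<open>- q\<close>.\<close>
  have mA: "deriv A \<tau> / sqrt (1 - (deriv A \<tau>)\<^sup>2) = p \<tau>" for \<tau>
    using momentum_speed[of "p \<tau>"] by (simp add: dA' momentum_def)
  have mb: "deriv b \<tau> / sqrt (1 - (deriv b \<tau>)\<^sup>2) = - q \<tau>" for \<tau>
    using momentum_speed[of "q \<tau>"] by (simp add: db' momentum_def)
  have "FST_solution A b"
    unfolding FST_solution_def adv ret adv' ret' mA mb
  proof (intro conjI allI)
    fix t
    show "\<bar>deriv A t\<bar> < 1" "\<bar>deriv b t\<bar> < 1" by (fact slow)+
    show "\<exists>s. s = t + \<bar>A s - b t\<bar>" "\<exists>s. s = t - \<bar>A s - b t\<bar>"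
      "\<exists>s. s = t + \<bar>A t - b s\<bar>" "\<exists>s. s = t - \<bar>A t - b s\<bar>"
      using adv_ex'[of t] ret_ex'[of t] adv_ex[of t] ret_ex[of t]
      unfolding abs_minus_commute[of "A t"] by blast+
    show "delay (- 1) B (A t) t \<noteq> 0" "delay 1 B (A t) t \<noteq> 0"
      "- delay (- 1) A (B t) t \<noteq> 0" "- delay 1 A (B t) t \<noteq> 0"
      using B_ahead(1)[of t] B_behind(1)[of t] regular_system.B_ahead(1)[OF sw, of t]
        regular_system.B_behind(1)[OF sw, of t] by simp_all
    show "(p has_real_derivative 1 / (delay (- 1) B (A t) t)\<^sup>2 + 1 / (delay 1 B (A t) t)\<^sup>2) (at t)"
      by (rule DERIV_p)
    show "((\<lambda>\<tau>. - q \<tau>) has_real_derivative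
        - (1 / (- delay (- 1) A (B t) t)\<^sup>2) - 1 / (- delay 1 A (B t) t)\<^sup>2) (at t)"
      using DERIV_minus[OF regular_system.DERIV_p[OF sw, of t]] by simp
  qed
  then show ?thesis unfolding b_def .
qed

end

section \<open>Choice of the cutoffs\<close>

theorem theorem1p3:
  fixes a0 b0 va0 vb0 :: real
  assumes "a0 > b0"
    and "va0 \<in> {-1<..<1}"
    and "vb0 \<in> {-1<..<1}"
  shows "\<exists>a b :: real \<Rightarrow> real. smooth a \<and> smooth b \<and> FST_solution a b \<and>
           a 0 = a0 \<and> deriv a 0 = va0 \<and> b 0 = b0 \<and> deriv b 0 = vb0"
proof -
  define P0 where "P0 = max \<bar>momentum va0\<bar> \<bar>momentum vb0\<bar>"
  define d0 where "d0 = a0 - b0"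
  define c where "c = 1 - speed P0"
  define m where "m = 1 / (4 / (c * d0) + 4 * P0 / c\<^sup>2)"
  define P1 where "P1 = momentum ((1 + speed P0) / 2)"
  define \<tau> where "\<tau> = 2 * d0 / c + 4 * d0\<^sup>2 * (P1 + P0 + 1) / c\<^sup>2"
  define \<eta> where "\<eta> = min (d0 / \<tau>) (c / 2)"
  define Pmax where "Pmax = P0 + 8 * \<tau> / m\<^sup>2 + 8 / (\<eta> * m)"
  \<comment> \<open>Above all momentum bounds of the a priori estimates. None of them involves
    \<open>Q\<close>, so the choice is not circular.\<close>
  define Q where "Q = P0 + \<bar>P1\<bar> + \<bar>Pmax\<bar> + 1"
  have bounds_P0: "0 \<le> P0" "\<bar>momentum va0\<bar> \<le> P0" "\<bar>momentum vb0\<bar> \<le> P0"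
    by (auto simp: P0_def)
  have bounds_Q: "0 < Q" "P0 < Q" "P1 < Q" "Pmax \<le> Q"
    using bounds_P0(1) by (auto simp: Q_def)
  have "0 < c" "0 < d0"
    using speed_bounded[of P0] assms(1) by (auto simp: c_def d0_def)
  then have m: "0 < m"
    using bounds_P0(1) by (auto simp: m_def intro!: add_pos_nonneg divide_pos_pos)
  \<comment> \<open>The second particle enters with position and momentum negated. The cutoff
    \<open>m / 2\<close> is below the distance bound \<open>m\<close> and, by
    \<open>delay_ge\<close>, at most every delay.\<close>
  obtain A B p q where init: "A 0 = a0" "B 0 = - b0" "p 0 = momentum va0" "q 0 = - momentum vb0"
    and ode: "\<And>t. (A has_real_derivative speed (clip (- Q) Q (p t))) (at t)"
      "\<And>t. (B has_real_derivative speed (clip (- Q) Q (q t))) (at t)"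
      "\<And>t. (p has_real_derivative force (m / 2) B (A t) t) (at t)"
      "\<And>t. (q has_real_derivative force (m / 2) A (B t) t) (at t)"
    using truncated_existence[of "m / 2" Q a0 "- b0" "momentum va0" "- momentum vb0"] m bounds_Q(1) by auto
  interpret separation A B p q "m / 2" Q P0 d0 c m P1 \<tau> \<eta>
    by (unfold_locales; (fact c_def m_def P1_def \<tau>_def \<eta>_def |
        (use m bounds_Q bounds_P0 init ode \<open>0 < d0\<close> in \<open>simp add: d0_def\<close>)))
  interpret s: separation B A q p "m / 2" Q P0 d0 c m P1 \<tau> \<eta>
    by (rule swap_separation)
  interpret regular_system A B p q "m / 2" Q
  proof
    show "\<bar>p t\<bar> \<le> Q" "\<bar>q t\<bar> \<le> Q" for t
      using bounds(2,3)[of t] bounds_Q(4) by (simp_all add: Pmax_def)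
    show "m / 2 \<le> delay \<sigma> B (A t) t" "m / 2 \<le> delay \<sigma> A (B t) t" if "\<bar>\<sigma>\<bar> = 1" for \<sigma> t
      using delay_ge[OF that, of t] s.delay_ge[OF that, of t] bounds(1)[of t] m by simp_all
  qed
  have "deriv A 0 = va0"
    using DERIV_imp_deriv[OF DERIV_A[of 0]] assms(2) init(3) by (simp add: speed_momentum abs_less_iff)
  moreover have "deriv (\<lambda>t. - B t) 0 = vb0"
    using DERIV_imp_deriv[OF DERIV_minus[OF regular_system.DERIV_A[OF swap_regular, of 0]]] assms(3) init(4)
    by (simp add: speed_momentum abs_less_iff)
  ultimately show ?thesis
    using smooth_A smooth_B FST init by (intro exI[of _ A] exI[of _ "\<lambda>t. - B t"]) simp
qed

end
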